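(* Let $\pi$ be a policy with $\min_{s\in\mathcal S,a\in\mathcal A}\pi(a|s)>0$ such that the Markov chain $\{s_t\}$ induced by $\pi$ under the nominal kernel $\mathbb P_N$ is aperiodic and irreducible, and let $\nu_{\min}=\min_{s,a}\nu^\pi(s,a)>0$, where $\nu^\pi$ is the stationary state-action distribution of $\pi$ under $\mathbb P_N$. For any $\epsilon>0$, let $\alpha_t=\alpha$ for some properly chosen $\alpha$; then the robust temporal difference (RTD) method finds an estimate $\theta_T$ satisfying $\mathbb E_\xi\|\theta_T-Q^\pi_r\|_\infty\le\epsilon$ in at most $$T=\widetilde{\mathcal O}\Big(\frac{\log^2(1/\epsilon)}{(1-\gamma)^5\nu_{\min}^3\epsilon^2}\Big)$$ iterations, where $\xi=\{\zeta_t\}_{t=0}^T$ denotes the trajectory collected by the RTD method and $\widetilde{\mathcal O}(\cdot)$ ignores polylogarithmic terms.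
   Context: Robust MDP. $\mathcal S,\mathcal A$ are finite state and action sets, $c:\mathcal S\times\mathcal A\to\mathbb R$ is a cost with $0<c(s,a)\le1$, $\gamma\in(0,1)$ is the discount factor, and $\mathbb P_{N}$ is a nominal transition kernel ($\mathbb P_N(\cdot|s,a)\in\Delta_{\mathcal S}$, where $\Delta_{\mathcal X}$ is the probability simplex over $\mathcal X$). The uncertainty set $\mathcal U\subset\mathbb R^{|\mathcal S|\times|\mathcal S|\times|\mathcal A|}$ is compact and $(s,a)$-rectangular: $\mathcal U=\prod_{s,a}\mathcal U_{s,a}$ with $\mathcal U_{s,a}=\{u(\cdot|s,a):u\in\mathcal U\}$; for every $u\in\mathcal U$, $\mathbb P_u(\cdot|s,a)=\mathbb P_N(\cdot|s,a)+u(\cdot|s,a)$ is a transition kernel. A policy is a stationary randomized policy ($\pi(\cdot|s)\in\Delta_{\mathcal A}$). $Q^\pi_u(s,a)=\mathbb E[\sum_{t\ge0}\gamma^t c(s_t,a_t)\mid s_0=s,a_0=a]$ under policy $\pi$ and kernel $\mathbb P_u$; $Q^\pi_r(s,a)=\max_{u\in\mathcal U}Q^\pi_u(s,a)$. RTD method. From $s_0\in\mathcal S$, $a_0\sim\pi(\cdot|s_0)$, $\theta_0\in\mathbb R^{|\mathcal S||\mathcal A|}$ and stepsizes $\{\alpha_t\}$, at each $t\ge0$: sample $s_{t+1}\sim\mathbb P_N(\cdot|s_t,a_t)$, $a_{t+1}\sim\pi(\cdot|s_{t+1})$, put $\zeta_t=(s_t,a_t,s_{t+1},a_{t+1})$ and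 $\theta_{t+1}=\theta_t+\alpha_t(f(\theta_t;\zeta_t)-\theta_t)$. With $\sigma_X(v)=\sup_{x\in X}\langle x,v\rangle$, $[M(\pi,x)](s)=\sum_a\pi(a|s)x(s,a)$, and $e(s,a)$ the standard basis vector of $\mathbb R^{|\mathcal S||\mathcal A|}$, for $\zeta=(s,a,s',a')$ the operator $f$ is one of the following. If $\mathcal U$ is known: $$f(x;\zeta)=\big(c(s,a)+\gamma x(s',a')+\gamma\sigma_{\mathcal U_{s,a}}(M(\pi,x))-x(s,a)\big)e(s,a)+x .$$ If $\mathcal U$ is unknown but of contamination form $\mathcal U_{s,a}=\{\varepsilon_c(q-\mathbb P_N(\cdot|s,a)):q\in\mathcal Q_{s,a}\}$ with $\varepsilon_c\in[0,1]$ and prespecified $\mathcal Q_{s,a}\subset\Delta_{\mathcal S}$: $$f(x;\zeta)=\big(c(s,a)+\gamma(1-\varepsilon_c)x(s',a')+\gamma\varepsilon_c\sigma_{\mathcal Q_{s,a}}(M(\pi,x))-x(s,a)\big)e(s,a)+x .$$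
   Formalization: The constant hidden in the soft-O may depend on the mixing time of the chain {s_t} under the policy and nominal kernel (a uniform constant is impossible for slowly flipping chains), and for ε > 1/2 the bound is taken at ε = 1/2, since log²(1/ε) vanishes at ε = 1. *)

theory Defs
  imports "HOL-Probability.Probability"
begin

section \<open>Finite Markov chains\<close>

text \<open>
  State and action sets are finite carrier sets \<open>S\<close>, \<open>A\<close> in arbitrary types, rather than types of
  class \<open>finite\<close>, so that a constant can be quantified before \<open>S\<close> and \<open>A\<close> and thus be independent
  of their sizes.  Vectors and kernels indexed by a carrier set are total functions; probability
  vectors and kernels vanish outside the carrier.
\<close>

definition prob_simplex :: "'x set \<Rightarrow> ('x \<Rightarrow> real) set" where
  "prob_simplex X = {p. (\<forall>x\<in>X. 0 \<le> p x) \<and> (\<forall>x. x \<notin> X \<longrightarrow> p x = 0) \<and> (\<Sum>x\<in>X. p x) = 1}"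

primrec kernel_pow :: "'x set \<Rightarrow> ('x \<Rightarrow> 'x \<Rightarrow> real) \<Rightarrow> nat \<Rightarrow> 'x \<Rightarrow> 'x \<Rightarrow> real" where
  "kernel_pow X K 0 x y = (if x = y then 1 else 0)"
| "kernel_pow X K (Suc n) x y = (\<Sum>z\<in>X. K x z * kernel_pow X K n z y)"

definition irreducible_chain :: "'x set \<Rightarrow> ('x \<Rightarrow> 'x \<Rightarrow> real) \<Rightarrow> bool" where
  "irreducible_chain X K \<longleftrightarrow> (\<forall>x\<in>X. \<forall>y\<in>X. \<exists>n. 0 < kernel_pow X K n x y)"

definition aperiodic_chain :: "'x set \<Rightarrow> ('x \<Rightarrow> 'x \<Rightarrow> real) \<Rightarrow> bool" where
  "aperiodic_chain X K \<longleftrightarrow> (\<forall>x\<in>X. Gcd {n. 1 \<le> n \<and> 0 < kernel_pow X K n x x} = 1)"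

definition stationary :: "'x set \<Rightarrow> ('x \<Rightarrow> 'x \<Rightarrow> real) \<Rightarrow> ('x \<Rightarrow> real) \<Rightarrow> bool" where
  "stationary X K \<nu> \<longleftrightarrow> \<nu> \<in> prob_simplex X \<and> (\<forall>y\<in>X. (\<Sum>x\<in>X. \<nu> x * K x y) = \<nu> y)"

text \<open>
  The usual mixing time: total variation distance to the stationary law at most 1/4.  A bound on
  the number of temporal difference steps cannot be uniform over all chains with a given smallest
  stationary probability: a two-state chain that flips with small probability \<open>p\<close> needs about
  \<open>1 / p\<close> steps to visit both states.  The implicit constant has to depend on the mixing time.
\<close>

definition mixing_time :: "'x set \<Rightarrow> ('x \<Rightarrow> 'x \<Rightarrow> real) \<Rightarrow> ('x \<Rightarrow> real) \<Rightarrow> nat" where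
  "mixing_time X K \<mu> =
     (LEAST n. \<forall>x\<in>X. (1 / 2) * (\<Sum>y\<in>X. \<bar>kernel_pow X K n x y - \<mu> y\<bar>) \<le> 1 / 4)"

text \<open>
  Law of the whole trajectory of the chain with initial distribution \<open>\<mu>\<close> and kernel \<open>K\<close>, as a
  measure on \<open>nat \<Rightarrow> 'x\<close> given by the Ionescu-Tulcea theorem.
\<close>

definition chain_step :: "'x set \<Rightarrow> ('x \<Rightarrow> real) \<Rightarrow> ('x \<Rightarrow> 'x \<Rightarrow> real) \<Rightarrow> nat \<Rightarrow> (nat \<Rightarrow> 'x) \<Rightarrow> 'x measure"
  where
  "chain_step X \<mu> K n \<omega> =
     point_measure X (\<lambda>x. ennreal (case n of 0 \<Rightarrow> \<mu> x | Suc m \<Rightarrow> K (\<omega> m) x))"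

definition chain_law :: "'x set \<Rightarrow> ('x \<Rightarrow> real) \<Rightarrow> ('x \<Rightarrow> 'x \<Rightarrow> real) \<Rightarrow> (nat \<Rightarrow> 'x) measure" where
  "chain_law X \<mu> K =
     projective_family.lim UNIV (Ionescu_Tulcea.CI (chain_step X \<mu> K) (\<lambda>_. count_space X))
       (\<lambda>_. count_space X)"

lemma prob_space_point_measure_simplex:
  assumes "finite X" "p \<in> prob_simplex X"
  shows "prob_space (point_measure X (\<lambda>x. ennreal (p x)))"
proof (rule prob_spaceI)
  have "emeasure (point_measure X (\<lambda>x. ennreal (p x))) X = (\<Sum>x\<in>X. ennreal (p x))"
    using assms by (intro emeasure_point_measure_finite) auto
  also have "\<dots> = ennreal (\<Sum>x\<in>X. p x)"
    using assms by (intro sum_ennreal) (auto simp: prob_simplex_def)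
  finally show "emeasure (point_measure X (\<lambda>x. ennreal (p x)))
      (space (point_measure X (\<lambda>x. ennreal (p x)))) = 1"
    using assms by (simp add: space_point_measure prob_simplex_def)
qed

lemma Ionescu_Tulcea_chain_step:
  assumes X: "finite X" and \<mu>: "\<mu> \<in> prob_simplex X" and K: "\<And>x. x \<in> X \<Longrightarrow> K x \<in> prob_simplex X"
  shows "Ionescu_Tulcea (chain_step X \<mu> K) (\<lambda>_. count_space X)"
proof (rule Ionescu_Tulcea.intro)
  fix n
  have *: "(\<lambda>x. point_measure X (\<lambda>y. ennreal (K x y)))
      \<in> measurable (count_space X) (subprob_algebra (count_space X))"
    using prob_space_point_measure_simplex[OF X K]
    by (auto simp: space_subprob_algebra sets_point_measure intro: prob_space_imp_subprob_space)
  show "chain_step X \<mu> K n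
      \<in> measurable (PiM {0..<n} (\<lambda>_. count_space X)) (subprob_algebra (count_space X))"
  proof (cases n)
    case 0
    have "point_measure X (\<lambda>x. ennreal (\<mu> x)) \<in> space (subprob_algebra (count_space X))"
      using prob_space_point_measure_simplex[OF X \<mu>]
      by (auto simp: space_subprob_algebra sets_point_measure intro: prob_space_imp_subprob_space)
    then show ?thesis
      using 0 by (simp add: chain_step_def[abs_def])
  next
    case (Suc m)
    have "(\<lambda>\<omega>. \<omega> m) \<in> measurable (PiM {0..<n} (\<lambda>_. count_space X)) (count_space X)"
      using Suc by (intro measurable_component_singleton) auto
    from measurable_compose[OF this *] show ?thesis
      using Suc by (simp add: chain_step_def[abs_def])
  qed
next
  fix n :: nat and \<omega> assume "\<omega> \<in> space (PiM {0..<n} (\<lambda>_. count_space X))"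
  then have "\<omega> m \<in> X" if "m < n" for m
    using that
    by (auto simp: space_PiM PiE_iff)
  then show "prob_space (chain_step X \<mu> K n \<omega>)"
    unfolding chain_step_def
    using prob_space_point_measure_simplex[OF X] \<mu> K by (cases n) auto
qed

lemma prob_space_chain_law:
  assumes "finite X" "\<mu> \<in> prob_simplex X" "\<And>x. x \<in> X \<Longrightarrow> K x \<in> prob_simplex X"
  shows "prob_space (chain_law X \<mu> K)"
proof -
  interpret Ionescu_Tulcea "chain_step X \<mu> K" "\<lambda>_. count_space X"
    using assms by (rule Ionescu_Tulcea_chain_step)
  have "prob_space (CI {})"
    by (rule PF.prob_space_P) auto
  then show ?thesis
    unfolding distr_lim[OF finite.emptyI, symmetric] chain_law_def[symmetric]
    by (rule prob_space_distrD[rotated])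
       (auto simp: chain_law_def measurable_cong_sets[OF PF.sets_lim] intro!: measurable_restrict)
qed


section \<open>Robust Markov decision processes\<close>

definition trans_kernels :: "'s set \<Rightarrow> 'a set \<Rightarrow> ('s \<times> 'a \<Rightarrow> 's \<Rightarrow> real) set" where
  "trans_kernels S A = {P. (\<forall>z\<in>S \<times> A. P z \<in> prob_simplex S) \<and> (\<forall>z. z \<notin> S \<times> A \<longrightarrow> P z = (\<lambda>_. 0))}"

definition perturbed_kernel ::
  "('s \<times> 'a \<Rightarrow> 's \<Rightarrow> real) \<Rightarrow> ('s \<times> 'a \<Rightarrow> 's \<Rightarrow> real) \<Rightarrow> 's \<times> 'a \<Rightarrow> 's \<Rightarrow> real" where
  "perturbed_kernel PN u = (\<lambda>z s'. PN z s' + u z s')"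

definition marginal_set :: "('s \<times> 'a \<Rightarrow> 's \<Rightarrow> real) set \<Rightarrow> 's \<times> 'a \<Rightarrow> ('s \<Rightarrow> real) set" where
  "marginal_set U z = (\<lambda>u. u z) ` U"

text \<open>
  By \<open>U_kernel\<close>, every \<open>u \<in> U\<close> vanishes outside the carrier, so \<open>U\<close> is a subset of a copy of
  \<open>\<real>\<^sup>|\<^sup>S\<^sup>|\<^sup>|\<^sup>S\<^sup>|\<^sup>|\<^sup>A\<^sup>|\<close>; on it the product topology of the function space, in which \<open>compact\<close> is
  taken, is the Euclidean one.
\<close>

locale robust_mdp =
  fixes S :: "'s set" and A :: "'a set" and c :: "'s \<times> 'a \<Rightarrow> real" and \<gamma> :: real
    and PN :: "'s \<times> 'a \<Rightarrow> 's \<Rightarrow> real" and U :: "('s \<times> 'a \<Rightarrow> 's \<Rightarrow> real) set"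
  assumes S: "finite S" "S \<noteq> {}"
    and A: "finite A" "A \<noteq> {}"
    and cost: "\<And>z. z \<in> S \<times> A \<Longrightarrow> 0 < c z \<and> c z \<le> 1"
    and discount: "0 < \<gamma>" "\<gamma> < 1"
    and nominal: "PN \<in> trans_kernels S A"
    and U_nonempty: "U \<noteq> {}"
    and U_compact: "compact U"
    and U_rectangular:
      "U = {u. (\<forall>z\<in>S \<times> A. u z \<in> marginal_set U z) \<and> (\<forall>z. z \<notin> S \<times> A \<longrightarrow> u z = (\<lambda>_. 0))}"
    and U_kernel: "\<And>u. u \<in> U \<Longrightarrow> perturbed_kernel PN u \<in> trans_kernels S A"

definition policies :: "'s set \<Rightarrow> 'a set \<Rightarrow> ('s \<Rightarrow> 'a \<Rightarrow> real) set" where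
  "policies S A = {\<pi>. \<forall>s\<in>S. \<pi> s \<in> prob_simplex A}"

definition state_kernel ::
  "'a set \<Rightarrow> ('s \<Rightarrow> 'a \<Rightarrow> real) \<Rightarrow> ('s \<times> 'a \<Rightarrow> 's \<Rightarrow> real) \<Rightarrow> 's \<Rightarrow> 's \<Rightarrow> real" where
  "state_kernel A \<pi> P s s' = (\<Sum>a\<in>A. \<pi> s a * P (s, a) s')"

definition state_action_kernel ::
  "('s \<Rightarrow> 'a \<Rightarrow> real) \<Rightarrow> ('s \<times> 'a \<Rightarrow> 's \<Rightarrow> real) \<Rightarrow> 's \<times> 'a \<Rightarrow> 's \<times> 'a \<Rightarrow> real" where
  "state_action_kernel \<pi> P z = (\<lambda>(s', a'). P z s' * \<pi> s' a')"

definition Q_value ::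
  "'s set \<Rightarrow> 'a set \<Rightarrow> ('s \<times> 'a \<Rightarrow> real) \<Rightarrow> real \<Rightarrow> ('s \<times> 'a \<Rightarrow> 's \<Rightarrow> real) \<Rightarrow> ('s \<Rightarrow> 'a \<Rightarrow> real)
    \<Rightarrow> 's \<times> 'a \<Rightarrow> real" where
  "Q_value S A c \<gamma> P \<pi> z =
     (LINT \<omega>|chain_law (S \<times> A) (\<lambda>z'. if z' = z then 1 else 0) (state_action_kernel \<pi> P).
        (\<Sum>t. \<gamma> ^ t * c (\<omega> t)))"

definition Q_robust ::
  "'s set \<Rightarrow> 'a set \<Rightarrow> ('s \<times> 'a \<Rightarrow> real) \<Rightarrow> real \<Rightarrow> ('s \<times> 'a \<Rightarrow> 's \<Rightarrow> real)
    \<Rightarrow> ('s \<times> 'a \<Rightarrow> 's \<Rightarrow> real) set \<Rightarrow> ('s \<Rightarrow> 'a \<Rightarrow> real) \<Rightarrow> 's \<times> 'a \<Rightarrow> real" where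
  "Q_robust S A c \<gamma> PN U \<pi> z = (SUP u\<in>U. Q_value S A c \<gamma> (perturbed_kernel PN u) \<pi> z)"


section \<open>Robust temporal difference learning\<close>

definition support_fun :: "'s set \<Rightarrow> ('s \<Rightarrow> real) set \<Rightarrow> ('s \<Rightarrow> real) \<Rightarrow> real" where
  "support_fun S X v = (SUP x\<in>X. \<Sum>s\<in>S. x s * v s)"

definition policy_avg :: "'a set \<Rightarrow> ('s \<Rightarrow> 'a \<Rightarrow> real) \<Rightarrow> ('s \<times> 'a \<Rightarrow> real) \<Rightarrow> 's \<Rightarrow> real" where
  "policy_avg A \<pi> x s = (\<Sum>a\<in>A. \<pi> s a * x (s, a))"

definition basis_vec :: "'z \<Rightarrow> 'z \<Rightarrow> real" where
  "basis_vec z = (\<lambda>z'. if z' = z then 1 else 0)"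

text \<open>A transition \<open>\<zeta> = (s, a, s', a')\<close> is represented as the pair \<open>((s, a), (s', a'))\<close>.\<close>

type_synonym ('s, 'a) td_operator =
  "('s \<times> 'a \<Rightarrow> real) \<Rightarrow> ('s \<times> 'a) \<times> ('s \<times> 'a) \<Rightarrow> ('s \<times> 'a \<Rightarrow> real)"

definition td_known ::
  "'s set \<Rightarrow> 'a set \<Rightarrow> ('s \<times> 'a \<Rightarrow> real) \<Rightarrow> real \<Rightarrow> ('s \<times> 'a \<Rightarrow> 's \<Rightarrow> real) set
    \<Rightarrow> ('s \<Rightarrow> 'a \<Rightarrow> real) \<Rightarrow> ('s, 'a) td_operator" where
  "td_known S A c \<gamma> U \<pi> x = (\<lambda>(z, z') y.
     (c z + \<gamma> * x z' + \<gamma> * support_fun S (marginal_set U z) (policy_avg A \<pi> x) - x z)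
       * basis_vec z y + x y)"

definition td_contaminated ::
  "'s set \<Rightarrow> 'a set \<Rightarrow> ('s \<times> 'a \<Rightarrow> real) \<Rightarrow> real \<Rightarrow> real \<Rightarrow> ('s \<times> 'a \<Rightarrow> ('s \<Rightarrow> real) set)
    \<Rightarrow> ('s \<Rightarrow> 'a \<Rightarrow> real) \<Rightarrow> ('s, 'a) td_operator" where
  "td_contaminated S A c \<gamma> \<epsilon>c QQ \<pi> x = (\<lambda>(z, z') y.
     (c z + \<gamma> * (1 - \<epsilon>c) * x z' + \<gamma> * \<epsilon>c * support_fun S (QQ z) (policy_avg A \<pi> x) - x z)
       * basis_vec z y + x y)"

definition contamination_form ::
  "'s set \<Rightarrow> 'a set \<Rightarrow> ('s \<times> 'a \<Rightarrow> 's \<Rightarrow> real) \<Rightarrow> ('s \<times> 'a \<Rightarrow> 's \<Rightarrow> real) set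
    \<Rightarrow> real \<Rightarrow> ('s \<times> 'a \<Rightarrow> ('s \<Rightarrow> real) set) \<Rightarrow> bool" where
  "contamination_form S A PN U \<epsilon>c QQ \<longleftrightarrow>
     0 \<le> \<epsilon>c \<and> \<epsilon>c \<le> 1 \<and>
     (\<forall>z\<in>S \<times> A. QQ z \<subseteq> prob_simplex S \<and>
        marginal_set U z = (\<lambda>q s'. \<epsilon>c * (q s' - PN z s')) ` QQ z)"

definition rtd_operator ::
  "'s set \<Rightarrow> 'a set \<Rightarrow> ('s \<times> 'a \<Rightarrow> real) \<Rightarrow> real \<Rightarrow> ('s \<times> 'a \<Rightarrow> 's \<Rightarrow> real)
    \<Rightarrow> ('s \<times> 'a \<Rightarrow> 's \<Rightarrow> real) set \<Rightarrow> ('s \<Rightarrow> 'a \<Rightarrow> real) \<Rightarrow> ('s, 'a) td_operator \<Rightarrow> bool" where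
  "rtd_operator S A c \<gamma> PN U \<pi> f \<longleftrightarrow>
     f = td_known S A c \<gamma> U \<pi> \<or>
     (\<exists>\<epsilon>c QQ. contamination_form S A PN U \<epsilon>c QQ \<and> f = td_contaminated S A c \<gamma> \<epsilon>c QQ \<pi>)"

text \<open>The iterates along a trajectory \<open>\<omega>\<close>, where \<open>\<omega> t = (s\<^sub>t, a\<^sub>t)\<close>.\<close>

primrec rtd :: "('s, 'a) td_operator \<Rightarrow> (nat \<Rightarrow> real) \<Rightarrow> ('s \<times> 'a \<Rightarrow> real) \<Rightarrow> (nat \<Rightarrow> 's \<times> 'a)
    \<Rightarrow> nat \<Rightarrow> 's \<times> 'a \<Rightarrow> real" where
  "rtd f \<alpha> \<theta>0 \<omega> 0 = \<theta>0"
| "rtd f \<alpha> \<theta>0 \<omega> (Suc t) = (\<lambda>y. rtd f \<alpha> \<theta>0 \<omega> t y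
     + \<alpha> t * (f (rtd f \<alpha> \<theta>0 \<omega> t) (\<omega> t, \<omega> (Suc t)) y - rtd f \<alpha> \<theta>0 \<omega> t y))"

definition rtd_trajectory ::
  "'s set \<Rightarrow> 'a set \<Rightarrow> ('s \<times> 'a \<Rightarrow> 's \<Rightarrow> real) \<Rightarrow> ('s \<Rightarrow> 'a \<Rightarrow> real) \<Rightarrow> 's \<Rightarrow> (nat \<Rightarrow> 's \<times> 'a) measure"
  where
  "rtd_trajectory S A PN \<pi> s0 =
     chain_law (S \<times> A) (\<lambda>(s, a). if s = s0 then \<pi> s a else 0) (state_action_kernel \<pi> PN)"

definition sup_norm :: "'z set \<Rightarrow> ('z \<Rightarrow> real) \<Rightarrow> real" where
  "sup_norm X x = Max ((\<lambda>z. \<bar>x z\<bar>) ` X)"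

text \<open>
  \<open>(ln (1 / \<epsilon>))\<^sup>2\<close> vanishes at \<open>\<epsilon> = 1\<close> and grows again beyond, so the rate is meaningful only
  for small \<open>\<epsilon>\<close>; it is to be taken at \<open>min \<epsilon> (1 / 2)\<close> when all \<open>\<epsilon> > 0\<close> are allowed.
\<close>

definition rtd_rate :: "real \<Rightarrow> real \<Rightarrow> real \<Rightarrow> real" where
  "rtd_rate \<epsilon> \<gamma> \<nu>min = (ln (1 / \<epsilon>))\<^sup>2 / ((1 - \<gamma>) ^ 5 * \<nu>min ^ 3 * \<epsilon>\<^sup>2)"

text \<open>
  A power of this factor is what the soft-O notation hides.  The dependence on \<open>\<epsilon>\<close> is fully
  displayed in \<open>rtd_rate\<close>, and logarithms of \<open>card S\<close>, \<open>card A\<close> are covered by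
  \<open>card S * card A \<le> 1 / \<nu>min\<close>.
\<close>

definition log_factor :: "real \<Rightarrow> real \<Rightarrow> real \<Rightarrow> real" where
  "log_factor \<gamma> \<nu>min r = 1 + ln (1 / (1 - \<gamma>)) + ln (1 / \<nu>min) + ln (1 + r)"

end

theory Submission
  imports Defs
begin

text \<open>
  With \<open>z\<^sub>t = (s\<^sub>t, a\<^sub>t)\<close> the RTD step is
  \<open>\<theta>\<^sub>t\<^sub>+\<^sub>1 = \<theta>\<^sub>t + \<alpha> (G \<theta>\<^sub>t z\<^sub>t - \<theta>\<^sub>t z\<^sub>t + \<kappa> D\<^sub>t) e(z\<^sub>t)\<close>, where \<open>G\<close> is the robust Bellman operator, a
  \<open>\<gamma>\<close>-contraction in the sup norm with fixed point \<open>Q\<^sub>r\<close>, and \<open>D\<^sub>t\<close> is a martingale difference.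
  Cut time into blocks of length \<open>B\<close> and take \<open>\<alpha> = 1 / (8 B)\<close>.  Within a block the part of the error
  driven by \<open>D\<close> alone has second moment of order \<open>1 / B\<close>, and after \<open>n\<close> visits to \<open>z\<close> the rest has
  contracted at \<open>z\<close> by the factor \<open>1 - (1 - \<gamma>) (1 - (1 - \<alpha>)\<^sup>n)\<close>.  The number of visits has mean about
  \<open>B \<nu>(z)\<close> and variance of order \<open>B\<close> times the mixing time \<open>\<tau>\<close>.  So over a block the expected error is
  multiplied by at most \<open>1 - (1 - \<gamma>) \<nu>\<^sub>m\<^sub>i\<^sub>n / 32\<close>, up to an additive term of order
  \<open>(\<tau> / B)\<^sup>1\<^sup>/\<^sup>2 / (1 - \<gamma>)\<close>.  This term is harmless for \<open>B\<close> of order \<open>\<tau> / (\<epsilon>\<^sup>2 (1 - \<gamma>)\<^sup>4 \<nu>\<^sub>m\<^sub>i\<^sub>n\<^sup>2)\<close>,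
  and the number of blocks is of order \<open>1 / ((1 - \<gamma>) \<nu>\<^sub>m\<^sub>i\<^sub>n)\<close> up to logarithms.
\<close>

section \<open>Finite-horizon expectations of a Markov chain\<close>

text \<open>
  The operator acts on functions of a pair: a state \<open>z\<close> of the chain and a variable \<open>x\<close> that each
  transition \<open>z \<rightarrow> z'\<close> updates deterministically.  Its powers give expectations along the
  trajectory as finite sums, and conditioning on the present becomes iteration of the operator.
\<close>

definition step_op ::
  "'z set \<Rightarrow> ('z \<Rightarrow> 'z \<Rightarrow> real) \<Rightarrow> ('x \<Rightarrow> 'z \<Rightarrow> 'z \<Rightarrow> 'x) \<Rightarrow> ('x \<Rightarrow> 'z \<Rightarrow> real) \<Rightarrow> 'x \<Rightarrow> 'z \<Rightarrow> real"
  where "step_op X K upd g x z = (\<Sum>z'\<in>X. K z z' * g (upd x z z') z')"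

primrec run :: "('x \<Rightarrow> 'z \<Rightarrow> 'z \<Rightarrow> 'x) \<Rightarrow> 'x \<Rightarrow> (nat \<Rightarrow> 'z) \<Rightarrow> nat \<Rightarrow> 'x" where
  "run upd x \<omega> 0 = x"
| "run upd x \<omega> (Suc t) = upd (run upd x \<omega> t) (\<omega> t) (\<omega> (Suc t))"

lemma run_fun_upd: "n < m \<Longrightarrow> run upd x (fun_upd \<omega> m y) n = run upd x \<omega> n"
  by (induction n) auto

lemma run_restrict: "n < m \<Longrightarrow> run upd x (restrict \<omega> {0..<m}) n = run upd x \<omega> n"
  by (induction n) auto

lemma step_op_nonneg:
  assumes "\<And>x z. z \<in> X \<Longrightarrow> K z \<in> prob_simplex X" "\<And>x z. z \<in> X \<Longrightarrow> 0 \<le> g x z" "z \<in> X"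
  shows "0 \<le> step_op X K upd g x z"
  using assms unfolding step_op_def prob_simplex_def by (intro sum_nonneg) auto

lemma nn_integral_point_measure_simplex:
  assumes "finite X" "p \<in> prob_simplex X" "\<And>y. y \<in> X \<Longrightarrow> 0 \<le> h y"
  shows "(\<integral>\<^sup>+y. ennreal (h y) \<partial>point_measure X (\<lambda>x. ennreal (p x))) = ennreal (\<Sum>y\<in>X. p y * h y)"
  using assms
  by (subst nn_integral_point_measure_finite)
     (auto simp: prob_simplex_def ennreal_mult'' mult.commute sum_ennreal[symmetric] simp del: sum_ennreal
       intro!: sum.cong)

section \<open>Laws of the trajectory up to a finite time\<close>

context
  fixes X :: "'z set" and \<mu> :: "'z \<Rightarrow> real" and K :: "'z \<Rightarrow> 'z \<Rightarrow> real"
  assumes X: "finite X" and \<mu>: "\<mu> \<in> prob_simplex X" and K: "\<And>x. x \<in> X \<Longrightarrow> K x \<in> prob_simplex X"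
begin

interpretation IT: Ionescu_Tulcea "chain_step X \<mu> K" "\<lambda>_. count_space X"
  using X \<mu> K by (rule Ionescu_Tulcea_chain_step)

text \<open>A finite product of finite discrete spaces is discrete, so every function of finitely
  many coordinates is measurable.\<close>

lemma PiM_lessThan_count_space:
  "PiM {0..<n} (\<lambda>_. count_space X) = count_space (PiE {0..<n :: nat} (\<lambda>_. X))"
  using X by (intro count_space_PiM_finite) (auto intro: countable_finite)

text \<open>The law of the first \<open>Suc m\<close> coordinates is that of the first
  \<open>m\<close> bound with the next transition, so the newest coordinate can be integrated out
  first.\<close>

lemma nn_integral_C_Suc:
  fixes h :: "(nat \<Rightarrow> 'z) \<Rightarrow> ennreal"
  shows "(\<integral>\<^sup>+\<omega>. h \<omega> \<partial>IT.C 0 (Suc m) (\<lambda>_. undefined)) =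
    (\<integral>\<^sup>+\<omega>. (\<integral>\<^sup>+y. h (fun_upd \<omega> m y) \<partial>chain_step X \<mu> K m \<omega>) \<partial>IT.C 0 m (\<lambda>_. undefined))"
proof -
  have u: "(\<lambda>_. undefined) \<in> space (PiM {0..<0::nat} (\<lambda>_. count_space X))"
    by simp
  have h: "h \<in> borel_measurable (PiM {0..<Suc m} (\<lambda>_. count_space X))"
    unfolding PiM_lessThan_count_space by simp
  have sp: "space (IT.C 0 m (\<lambda>_. undefined)) = space (PiM {0..<m} (\<lambda>_. count_space X))"
    using IT.space_C[OF u, of m] by simp
  have st: "sets (IT.C 0 m (\<lambda>_. undefined)) = sets (PiM {0..<m} (\<lambda>_. count_space X))"
    using IT.sets_C[OF u, of m] by simp
  have "(\<integral>\<^sup>+\<omega>. h \<omega> \<partial>IT.C 0 (Suc m) (\<lambda>_. undefined)) =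
      (\<integral>\<^sup>+\<omega>. (\<integral>\<^sup>+y. h y \<partial>IT.eP m \<omega>) \<partial>IT.C 0 m (\<lambda>_. undefined))"
    using h IT.measurable_eP[of m] measurable_cong_sets[OF st refl, of "subprob_algebra (PiM {0..<Suc m} (\<lambda>_. count_space X))"]
    by (simp, subst nn_integral_bind[where B="PiM {0..<Suc m} (\<lambda>_. count_space X)"]) auto
  also have "\<dots> = (\<integral>\<^sup>+\<omega>. (\<integral>\<^sup>+y. h (fun_upd \<omega> m y) \<partial>chain_step X \<mu> K m \<omega>) \<partial>IT.C 0 m (\<lambda>_. undefined))"
    by (intro nn_integral_cong IT.nn_integral_eP h) (simp add: sp)
  finally show ?thesis .
qed

text \<open>Averaging over the last transition replaces \<open>g\<close> by
  \<open>step_op X K upd g\<close> one time earlier, so the induction on \<open>n\<close>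
  generalizes \<open>g\<close>.\<close>

lemma nn_integral_C_run:
  fixes g :: "'x \<Rightarrow> 'z \<Rightarrow> real"
  assumes "\<And>x z. z \<in> X \<Longrightarrow> 0 \<le> g x z"
  shows "(\<integral>\<^sup>+\<omega>. ennreal (g (run upd x \<omega> n) (\<omega> n)) \<partial>IT.C 0 (Suc n) (\<lambda>_. undefined))
    = ennreal (\<Sum>z\<in>X. \<mu> z * (step_op X K upd ^^ n) g x z)"
  using assms
proof (induction n arbitrary: g)
  case 0
  have "IT.C 0 0 (\<lambda>_. undefined) = return (PiM {} (\<lambda>_. count_space X)) (\<lambda>_. undefined)"
    by simp
  then show ?case
    unfolding nn_integral_C_Suc
    using nn_integral_point_measure_simplex[OF X \<mu>, of "g x"] 0
    by (simp add: chain_step_def emeasure_return PiM_empty)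
next
  case (Suc n)
  have u: "(\<lambda>_. undefined) \<in> space (PiM {0..<0::nat} (\<lambda>_. count_space X))"
    by simp
  have "(\<integral>\<^sup>+\<omega>. ennreal (g (run upd x \<omega> (Suc n)) (\<omega> (Suc n))) \<partial>IT.C 0 (Suc (Suc n)) (\<lambda>_. undefined))
    = (\<integral>\<^sup>+\<omega>. ennreal (step_op X K upd g (run upd x \<omega> n) (\<omega> n)) \<partial>IT.C 0 (Suc n) (\<lambda>_. undefined))"
    unfolding nn_integral_C_Suc[where m="Suc n"]
  proof (rule nn_integral_cong)
    fix \<omega> assume "\<omega> \<in> space (IT.C 0 (Suc n) (\<lambda>_. undefined))"
    then have "\<omega> n \<in> X"
      using IT.space_C[OF u, of "Suc n"] by (auto simp: space_PiM simp del: IT.C.simps)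
    then show "(\<integral>\<^sup>+y. ennreal (g (run upd x (fun_upd \<omega> (Suc n) y) (Suc n)) ((fun_upd \<omega> (Suc n) y) (Suc n)))
        \<partial>chain_step X \<mu> K (Suc n) \<omega>) = ennreal (step_op X K upd g (run upd x \<omega> n) (\<omega> n))"
      using nn_integral_point_measure_simplex[OF X K, of "\<omega> n" "\<lambda>y. g (upd (run upd x \<omega> n) (\<omega> n) y) y"]
        Suc.prems
      by (simp add: chain_step_def run_fun_upd step_op_def)
  qed
  also have "\<dots> = ennreal (\<Sum>z\<in>X. \<mu> z * (step_op X K upd ^^ Suc n) g x z)"
    using step_op_nonneg[OF K Suc.prems] by (subst Suc.IH) (auto simp: funpow_swap1 simp del: IT.C.simps)
  finally show ?case .
qed

lemma space_chain_law: "space (chain_law X \<mu> K) = PiE UNIV (\<lambda>_. X)"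
  unfolding chain_law_def by (simp add: IT.PF.space_lim space_PiM)

lemma sets_chain_law: "sets (chain_law X \<mu> K) = sets (PiM UNIV (\<lambda>_. count_space X))"
  unfolding chain_law_def by simp

lemma distr_chain_law_restrict:
  "distr (chain_law X \<mu> K) (PiM {0..<n} (\<lambda>_. count_space X)) (\<lambda>\<omega>. restrict \<omega> {0..<n})
    = IT.C 0 n (\<lambda>_. undefined)"
proof -
  have u: "(\<lambda>_. undefined) \<in> space (PiM {0..<0::nat} (\<lambda>_. count_space X))"
    by simp
  \<comment> \<open>\<open>IT.CI\<close> realizes a finite index set inside the shortest initial
    segment covering it, which for \<open>{0..<n}\<close> is the set itself.\<close>
  have "IT.up_to {0..<n} = n"
    using IT.up_to_iff[of "{0..<n}" n] IT.up_to_iff[of "{0..<n}" "IT.up_to {0..<n}"]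
      le_antisym[of "IT.up_to {0..<n}" n] by (metis atLeastLessThan_iff finite_atLeastLessThan le0 linorder_not_less nless_le)
  then have "IT.CI {0..<n} = IT.C 0 n (\<lambda>_. undefined)"
    using IT.distr_C[of n n "\<lambda>_. undefined" 0] u by (simp add: IT.CI_def)
  then show ?thesis
    unfolding chain_law_def using IT.distr_lim[of "{0..<n}"] by simp
qed

lemma measurable_restrict_chain_law:
  "(\<lambda>\<omega>. restrict \<omega> {0..<n}) \<in> measurable (chain_law X \<mu> K) (PiM {0..<n} (\<lambda>_. count_space X))"
  unfolding measurable_cong_sets[OF sets_chain_law refl] by (intro measurable_restrict_subset) auto

lemma measurable_run_chain_law:
  fixes g :: "'x \<Rightarrow> 'z \<Rightarrow> real"
  shows "(\<lambda>\<omega>. g (run upd x \<omega> n) (\<omega> n)) \<in> borel_measurable (chain_law X \<mu> K)"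
proof -
  have "(\<lambda>\<omega>. g (run upd x \<omega> n) (\<omega> n)) \<in> borel_measurable (PiM {0..<Suc n} (\<lambda>_. count_space X))"
    unfolding PiM_lessThan_count_space by simp
  from measurable_compose[OF measurable_restrict_chain_law this] show ?thesis
    by (simp add: run_restrict)
qed

lemma nn_integral_chain_law_run:
  fixes g :: "'x \<Rightarrow> 'z \<Rightarrow> real"
  assumes "\<And>x z. z \<in> X \<Longrightarrow> 0 \<le> g x z"
  shows "(\<integral>\<^sup>+\<omega>. ennreal (g (run upd x \<omega> n) (\<omega> n)) \<partial>chain_law X \<mu> K)
    = ennreal (\<Sum>z\<in>X. \<mu> z * (step_op X K upd ^^ n) g x z)"
proof -
  have m: "(\<lambda>\<omega>. ennreal (g (run upd x \<omega> n) (\<omega> n))) \<in> borel_measurable (PiM {0..<Suc n} (\<lambda>_. count_space X))"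
    unfolding PiM_lessThan_count_space by simp
  have m': "(\<lambda>\<omega>. ennreal (g (run upd x \<omega> n) (\<omega> n))) \<in> borel_measurable (IT.C 0 (Suc n) (\<lambda>_. undefined))"
    using m measurable_cong_sets[OF IT.sets_C[of "\<lambda>_. undefined" 0 "Suc n"] refl, of "borel :: ennreal measure"]
    by (simp del: IT.C.simps)
  have "(\<integral>\<^sup>+\<omega>. ennreal (g (run upd x \<omega> n) (\<omega> n)) \<partial>chain_law X \<mu> K)
      = (\<integral>\<^sup>+\<omega>. ennreal (g (run upd x \<omega> n) (\<omega> n)) \<partial>IT.C 0 (Suc n) (\<lambda>_. undefined))"
    using m' unfolding distr_chain_law_restrict[symmetric]
    by (subst nn_integral_distr[OF measurable_restrict_chain_law]) (auto simp: run_restrict)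
  then show ?thesis
    using nn_integral_C_run[where g=g and upd=upd and x=x and n=n, OF assms] by simp
qed

lemma integral_chain_law_run:
  fixes g :: "'x \<Rightarrow> 'z \<Rightarrow> real"
  assumes "\<And>x z. z \<in> X \<Longrightarrow> 0 \<le> g x z"
  shows "(LINT \<omega>|chain_law X \<mu> K. g (run upd x \<omega> n) (\<omega> n))
    = (\<Sum>z\<in>X. \<mu> z * (step_op X K upd ^^ n) g x z)"
    and "integrable (chain_law X \<mu> K) (\<lambda>\<omega>. g (run upd x \<omega> n) (\<omega> n))"
proof -
  have pos: "AE \<omega> in chain_law X \<mu> K. 0 \<le> g (run upd x \<omega> n) (\<omega> n)"
    by (rule AE_I2) (auto simp: space_chain_law intro!: assms)
  have "0 \<le> (step_op X K upd ^^ n) g x z" if "z \<in> X" for x z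
    using that assms by (induction n arbitrary: x z) (auto intro!: step_op_nonneg K)
  then have "0 \<le> (\<Sum>z\<in>X. \<mu> z * (step_op X K upd ^^ n) g x z)"
    using \<mu> by (intro sum_nonneg) (auto simp: prob_simplex_def)
  then show "(LINT \<omega>|chain_law X \<mu> K. g (run upd x \<omega> n) (\<omega> n))
    = (\<Sum>z\<in>X. \<mu> z * (step_op X K upd ^^ n) g x z)"
    by (subst integral_eq_nn_integral[OF measurable_run_chain_law pos],
        subst nn_integral_chain_law_run[OF assms]) auto
  show "integrable (chain_law X \<mu> K) (\<lambda>\<omega>. g (run upd x \<omega> n) (\<omega> n))"
    by (rule integrableI_nonneg[OF measurable_run_chain_law pos])
       (subst nn_integral_chain_law_run[OF assms]; simp)
qed

end

section \<open>Mixing of finite chains\<close>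

lemma mem_additive_mult:
  assumes add: "\<And>m n. m \<in> R \<Longrightarrow> n \<in> R \<Longrightarrow> m + n \<in> R" and "n \<in> R" "0 < k"
  shows "k * n \<in> (R :: nat set)"
  using \<open>0 < k\<close>
proof (induction k)
  case (Suc k)
  then show ?case
    using assms(2) add[of n "k * n"] by (cases "k = 0") auto
qed simp

text \<open>
  The least difference \<open>d\<close> of two elements divides every element: for \<open>m = q d + r\<close> with
  \<open>0 < r < d\<close>, the elements \<open>m + (q + 1) n\<close> and \<open>(q + 1) (n + d)\<close> would differ by \<open>d - r\<close>.
  Hence \<open>R\<close> contains two consecutive numbers.
\<close>

lemma additive_Gcd_1_eventually:
  fixes R :: "nat set"
  assumes add: "\<And>m n. m \<in> R \<Longrightarrow> n \<in> R \<Longrightarrow> m + n \<in> R" and pos: "0 \<notin> R" and Gcd: "Gcd R = 1"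
  shows "\<exists>N. \<forall>k\<ge>N. k \<in> R"
proof -
  have "R \<noteq> {}"
    using Gcd by auto
  then obtain n0 where n0: "n0 \<in> R" by auto
  have "\<exists>d. 0 < d \<and> (\<exists>n. n \<in> R \<and> n + d \<in> R)"
    using n0 pos add[OF n0 n0] by (intro exI[of _ n0]) (auto intro: gr0I)
  then obtain d where d: "0 < d" "\<exists>n. n \<in> R \<and> n + d \<in> R"
    and min: "\<And>e. e < d \<Longrightarrow> \<not> (0 < e \<and> (\<exists>n. n \<in> R \<and> n + e \<in> R))"
    using exists_least_iff[of "\<lambda>d. 0 < d \<and> (\<exists>n. n \<in> R \<and> n + d \<in> R)"] by auto
  obtain n where n: "n \<in> R" "n + d \<in> R" using d by auto
  have "d dvd m" if m: "m \<in> R" for m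
  proof (rule ccontr)
    assume "\<not> d dvd m"
    define q r where "q = m div d" and "r = m mod d"
    have r: "0 < r" "r < d" and mq: "m = q * d + r"
      using d(1) \<open>\<not> d dvd m\<close> by (auto simp: q_def r_def dvd_eq_mod_eq_0)
    have "m + (q + 1) * n \<in> R" "(q + 1) * (n + d) \<in> R"
      using mem_additive_mult[OF add n(1), of "q + 1"] mem_additive_mult[OF add n(2), of "q + 1"] add m
      by auto
    moreover have "(q + 1) * (n + d) = (m + (q + 1) * n) + (d - r)"
      using r by (simp add: mq algebra_simps)
    ultimately show False
      using min[of "d - r"] r by auto
  qed
  then have "d dvd 1"
    using Gcd Gcd_greatest by metis
  then have Suc: "Suc n \<in> R" using n by simp
  have "0 < n" using n pos by (auto intro: gr0I)
  \<comment> \<open>For \<open>k = q n + r\<close> with \<open>r < n\<close>, the lower bound on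
    \<open>k\<close> gives \<open>n \<le> q\<close>, so \<open>k = (q - r) n + r (n + 1)\<close> is
    a combination of the two consecutive elements.\<close>
  have "k \<in> R" if "n * n \<le> k" for k
  proof -
    define q r where "q = k div n" and "r = k mod n"
    have r: "r < n" "n \<le> q" and kq: "k = q * n + r"
      using \<open>0 < n\<close> that by (auto simp: q_def r_def less_eq_div_iff_mult_less_eq)
    have "k = (q - r) * n + r * Suc n"
      using r by (simp add: kq algebra_simps diff_mult_distrib)
    moreover have "(q - r) * n \<in> R"
      using r by (intro mem_additive_mult[OF add n(1)]) auto
    moreover have "r * Suc n \<in> R" if "0 < r"
      using that by (intro mem_additive_mult[OF add Suc]) auto
    ultimately show ?thesis
      using add by (cases "r = 0") auto
  qed
  then show ?thesis by blast
qed

lemma prob_simplexD: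
  assumes "p \<in> prob_simplex X"
  shows "0 \<le> p x" "(\<Sum>x\<in>X. p x) = 1"
  using assms unfolding prob_simplex_def by force+

section \<open>Powers of a stochastic kernel\<close>

context
  fixes X :: "'z set" and K :: "'z \<Rightarrow> 'z \<Rightarrow> real"
  assumes X: "finite X" and K: "\<And>x. x \<in> X \<Longrightarrow> K x \<in> prob_simplex X"
begin

lemma kernel_pow_nonneg: "x \<in> X \<Longrightarrow> 0 \<le> kernel_pow X K n x y"
  by (induction n arbitrary: x) (auto intro!: sum_nonneg mult_nonneg_nonneg prob_simplexD[OF K])

lemma sum_kernel_pow: "x \<in> X \<Longrightarrow> (\<Sum>y\<in>X. kernel_pow X K n x y) = 1"
proof (induction n arbitrary: x)
  case (Suc n)
  have "(\<Sum>y\<in>X. kernel_pow X K (Suc n) x y) = (\<Sum>z\<in>X. K x z * (\<Sum>y\<in>X. kernel_pow X K n z y))"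
    by (simp add: sum_distrib_left) (rule sum.swap)
  also have "\<dots> = 1"
    using Suc prob_simplexD(2)[OF K] by simp
  finally show ?case .
qed (use X in simp)

lemma kernel_pow_add:
  "x \<in> X \<Longrightarrow> kernel_pow X K (m + n) x y = (\<Sum>z\<in>X. kernel_pow X K m x z * kernel_pow X K n z y)"
proof (induction m arbitrary: x)
  case 0
  have "(\<Sum>z\<in>X. kernel_pow X K 0 x z * kernel_pow X K n z y)
      = (\<Sum>z\<in>X. if x = z then kernel_pow X K n z y else 0)"
    by (intro sum.cong) auto
  then show ?case using X 0 by simp
next
  case (Suc m)
  have "kernel_pow X K (Suc m + n) x y
      = (\<Sum>w\<in>X. \<Sum>z\<in>X. K x w * (kernel_pow X K m w z * kernel_pow X K n z y))"
    using Suc.IH by (simp add: sum_distrib_left)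
  also have "\<dots> = (\<Sum>z\<in>X. kernel_pow X K (Suc m) x z * kernel_pow X K n z y)"
    by (subst sum.swap) (simp add: sum_distrib_right mult.assoc)
  finally show ?case .
qed

lemma kernel_pow_add_pos:
  assumes "x \<in> X" "z \<in> X" "0 < kernel_pow X K m x z" "0 < kernel_pow X K n z y"
  shows "0 < kernel_pow X K (m + n) x y"
proof -
  have "0 < kernel_pow X K m x z * kernel_pow X K n z y"
    using assms by simp
  also have "\<dots> \<le> kernel_pow X K (m + n) x y"
    using assms X unfolding kernel_pow_add[OF assms(1)]
    by (intro member_le_sum) (auto intro!: mult_nonneg_nonneg kernel_pow_nonneg)
  finally show ?thesis .
qed

text \<open>The return times to \<open>x\<close> are closed under addition and have gcd 1, hence
  contain all large numbers; appending a path from \<open>x\<close> to \<open>y\<close> and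
  maximizing over the finitely many pairs gives a common time.\<close>

lemma primitive_chain:
  assumes irr: "irreducible_chain X K" and aper: "aperiodic_chain X K"
  shows "\<exists>N. \<forall>x\<in>X. \<forall>y\<in>X. 0 < kernel_pow X K N x y"
proof -
  have "\<exists>N. \<forall>n\<ge>N. 0 < kernel_pow X K n x y" if x: "x \<in> X" and y: "y \<in> X" for x y
  proof -
    let ?R = "{n. 1 \<le> n \<and> 0 < kernel_pow X K n x x}"
    have "\<exists>N. \<forall>k\<ge>N. k \<in> ?R"
      using aper x kernel_pow_add_pos[OF x x]
      by (intro additive_Gcd_1_eventually) (auto simp: aperiodic_chain_def)
    then obtain N where N: "\<And>k. N \<le> k \<Longrightarrow> 0 < kernel_pow X K k x x" by auto
    obtain m where m: "0 < kernel_pow X K m x y"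
      using irr x y by (auto simp: irreducible_chain_def)
    have "0 < kernel_pow X K n x y" if "N + m \<le> n" for n
      using kernel_pow_add_pos[OF x x N m, of "n - m"] that by auto
    then show ?thesis by blast
  qed
  then obtain N where N: "\<And>x y n. x \<in> X \<Longrightarrow> y \<in> X \<Longrightarrow> N x y \<le> n \<Longrightarrow> 0 < kernel_pow X K n x y"
    by metis
  define M where "M = Max ((\<lambda>(x, y). N x y) ` (X \<times> X))"
  have "N x y \<le> M" if "x \<in> X" "y \<in> X" for x y
    unfolding M_def using X that by (intro Max_ge) auto
  then show ?thesis using N by blast
qed

section \<open>Convergence to the stationary law\<close>

context
  fixes \<mu> :: "'z \<Rightarrow> real"
  assumes \<mu>: "stationary X K \<mu>"
begin

lemma stationary_kernel_pow: "y \<in> X \<Longrightarrow> (\<Sum>x\<in>X. \<mu> x * kernel_pow X K n x y) = \<mu> y"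
proof (induction n)
  case 0
  have "(\<Sum>x\<in>X. \<mu> x * kernel_pow X K 0 x y) = (\<Sum>x\<in>X. if x = y then \<mu> x else 0)"
    by (intro sum.cong) auto
  then show ?case using X 0 by simp
next
  case (Suc n)
  have "(\<Sum>x\<in>X. \<mu> x * kernel_pow X K (Suc n) x y)
      = (\<Sum>z\<in>X. (\<Sum>x\<in>X. \<mu> x * K x z) * kernel_pow X K n z y)"
    by (simp add: sum_distrib_left sum_distrib_right mult.assoc) (rule sum.swap)
  also have "\<dots> = (\<Sum>z\<in>X. \<mu> z * kernel_pow X K n z y)"
    using \<mu> by (auto simp: stationary_def)
  finally show ?case using Suc by simp
qed

text \<open>
  The signed measure \<open>kernel_pow X K n x - \<mu>\<close> has total mass 0, so the reference vector \<open>r\<close> may be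
  subtracted from every row of the \<open>m\<close>-step kernel; \<open>r = \<mu>\<close> gives the decay by the mixing time and a
  constant \<open>r\<close> the Doeblin contraction.
\<close>

lemma kernel_pow_L1_contract:
  assumes r: "\<And>z. z \<in> X \<Longrightarrow> (\<Sum>y\<in>X. \<bar>kernel_pow X K m z y - r y\<bar>) \<le> \<rho>" and x: "x \<in> X"
  shows "(\<Sum>y\<in>X. \<bar>kernel_pow X K (n + m) x y - \<mu> y\<bar>) \<le> \<rho> * (\<Sum>y\<in>X. \<bar>kernel_pow X K n x y - \<mu> y\<bar>)"
proof -
  define f where "f z = kernel_pow X K n x z - \<mu> z" for z
  have f0: "(\<Sum>z\<in>X. f z) = 0"
    using sum_kernel_pow[OF x] \<mu> by (simp add: f_def sum_subtractf stationary_def prob_simplex_def)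
  have eq: "kernel_pow X K (n + m) x y - \<mu> y = (\<Sum>z\<in>X. f z * (kernel_pow X K m z y - r y))" if "y \<in> X" for y
  proof -
    have "(\<Sum>z\<in>X. f z * (kernel_pow X K m z y - r y)) = (\<Sum>z\<in>X. f z * kernel_pow X K m z y) - (\<Sum>z\<in>X. f z) * r y"
      by (simp add: right_diff_distrib sum_subtractf sum_distrib_right)
    also have "\<dots> = kernel_pow X K (n + m) x y - \<mu> y"
      using stationary_kernel_pow[OF that, of m] kernel_pow_add[OF x, of n m y] f0
      by (simp add: f_def left_diff_distrib sum_subtractf)
    finally show ?thesis by simp
  qed
  have "(\<Sum>y\<in>X. \<bar>kernel_pow X K (n + m) x y - \<mu> y\<bar>)
      \<le> (\<Sum>y\<in>X. \<Sum>z\<in>X. \<bar>f z\<bar> * \<bar>kernel_pow X K m z y - r y\<bar>)"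
    by (intro sum_mono, subst eq) (auto intro!: order_trans[OF sum_abs] simp: abs_mult)
  also have "\<dots> = (\<Sum>z\<in>X. \<bar>f z\<bar> * (\<Sum>y\<in>X. \<bar>kernel_pow X K m z y - r y\<bar>))"
    by (subst sum.swap) (simp add: sum_distrib_left)
  also have "\<dots> \<le> (\<Sum>z\<in>X. \<bar>f z\<bar> * \<rho>)"
    by (intro sum_mono mult_left_mono r) auto
  also have "\<dots> = \<rho> * (\<Sum>z\<in>X. \<bar>f z\<bar>)"
    by (simp add: sum_distrib_left mult.commute)
  finally show ?thesis
    unfolding f_def .
qed

lemma kernel_pow_L1_le_2:
  assumes "x \<in> X"
  shows "(\<Sum>y\<in>X. \<bar>kernel_pow X K n x y - \<mu> y\<bar>) \<le> 2"
proof -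
  have "\<mu> \<in> prob_simplex X" using \<mu> by (simp add: stationary_def)
  then have "(\<Sum>y\<in>X. \<bar>kernel_pow X K n x y - \<mu> y\<bar>) \<le> (\<Sum>y\<in>X. kernel_pow X K n x y + \<mu> y)"
    using kernel_pow_nonneg[OF assms] prob_simplexD(1)[of \<mu> X]
    by (intro sum_mono) (auto simp: abs_le_iff add_increasing add_increasing2)
  also have "\<dots> = 2"
    using sum_kernel_pow[OF assms] prob_simplexD(2)[of \<mu> X] \<open>\<mu> \<in> prob_simplex X\<close>
    by (simp add: sum.distrib)
  finally show ?thesis .
qed

text \<open>Doeblin's argument: if all \<open>N\<close>-step probabilities are at least \<delta>,
  subtracting the constant \<delta> leaves rows of mass \<open>1 - card X * \<delta> < 1\<close>, so
  the distance decays geometrically. It guarantees that the minimum defining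
  \<open>mixing_time\<close> is attained.\<close>

lemma mixing_exists:
  assumes irr: "irreducible_chain X K" and aper: "aperiodic_chain X K"
  shows "\<exists>n. \<forall>x\<in>X. (\<Sum>y\<in>X. \<bar>kernel_pow X K n x y - \<mu> y\<bar>) \<le> 1 / 2"
proof -
  obtain N where N: "\<And>x y. x \<in> X \<Longrightarrow> y \<in> X \<Longrightarrow> 0 < kernel_pow X K N x y"
    using primitive_chain[OF irr aper] by blast
  have ne: "X \<noteq> {}"
    using \<mu> by (auto simp: stationary_def prob_simplex_def)
  define \<delta> where "\<delta> = Min ((\<lambda>(x, y). kernel_pow X K N x y) ` (X \<times> X))"
  have \<delta>: "0 < \<delta>"
    unfolding \<delta>_def using X ne N by (subst Min_gr_iff) auto
  have \<delta>_le: "\<delta> \<le> kernel_pow X K N x y" if "x \<in> X" "y \<in> X" for x y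
    unfolding \<delta>_def using X that by (intro Min_le) auto
  define \<rho> where "\<rho> = 1 - card X * \<delta>"
  have row: "(\<Sum>y\<in>X. \<bar>kernel_pow X K N z y - \<delta>\<bar>) = \<rho>" if "z \<in> X" for z
  proof -
    have "(\<Sum>y\<in>X. \<bar>kernel_pow X K N z y - \<delta>\<bar>) = (\<Sum>y\<in>X. kernel_pow X K N z y - \<delta>)"
      using \<delta>_le that by (intro sum.cong) auto
    then show ?thesis
      using sum_kernel_pow[OF that] by (simp add: \<rho>_def sum_subtractf)
  qed
  have "0 \<le> \<rho>"
    using row ne by (metis (no_types, lifting) abs_ge_zero ex_in_conv sum_nonneg)
  moreover have "\<rho> < 1"
    using \<delta> ne X by (simp add: \<rho>_def card_gt_0_iff)
  \<comment> \<open>The initial distance can be as large as 2, hence 1/4 rather than 1/2.\<close>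
  ultimately obtain k where k: "\<rho> ^ k < 1 / 4"
    using real_arch_pow_inv[of "1 / 4" \<rho>] by auto
  have "(\<Sum>y\<in>X. \<bar>kernel_pow X K (k * N) x y - \<mu> y\<bar>) \<le> \<rho> ^ k * 2" if "x \<in> X" for x k
  proof (induction k)
    case 0
    then show ?case using kernel_pow_L1_le_2[OF that, of 0] by simp
  next
    case (Suc k)
    have "(\<Sum>y\<in>X. \<bar>kernel_pow X K (Suc k * N) x y - \<mu> y\<bar>)
        \<le> \<rho> * (\<Sum>y\<in>X. \<bar>kernel_pow X K (k * N) x y - \<mu> y\<bar>)"
      using kernel_pow_L1_contract[of N "\<lambda>_. \<delta>" \<rho> x "k * N"] row that by (simp add: add.commute)
    also have "\<dots> \<le> \<rho> * (\<rho> ^ k * 2)"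
      using Suc \<open>0 \<le> \<rho>\<close> by (intro mult_left_mono)
    finally show ?case by simp
  qed
  moreover have "\<rho> ^ k * 2 \<le> 1 / 2"
    using k by simp
  ultimately show ?thesis
    using order_trans by blast
qed

text \<open>Shifting time by the mixing time halves the distance, so the sum \<open>s\<close> of the
  distances satisfies \<open>s \<le> 2 t + s / 2\<close>. Total variation 1/4 in
  \<open>mixing_time\<close> is distance 1/2 in the sum norm used here.\<close>

lemma sum_kernel_pow_L1_le:
  assumes irr: "irreducible_chain X K" and aper: "aperiodic_chain X K" and x: "x \<in> X"
  shows "(\<Sum>i<n. \<Sum>y\<in>X. \<bar>kernel_pow X K i x y - \<mu> y\<bar>) \<le> 4 * real (mixing_time X K \<mu>)"
proof -
  let ?t = "mixing_time X K \<mu>"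
  define a where "a i = (\<Sum>y\<in>X. \<bar>kernel_pow X K i x y - \<mu> y\<bar>)" for i
  have "\<exists>n. \<forall>z\<in>X. 1 / 2 * (\<Sum>y\<in>X. \<bar>kernel_pow X K n z y - \<mu> y\<bar>) \<le> 1 / 4"
    using mixing_exists[OF irr aper] by (simp add: mult.commute)
  from LeastI_ex[OF this] have "\<forall>z\<in>X. 1 / 2 * (\<Sum>y\<in>X. \<bar>kernel_pow X K ?t z y - \<mu> y\<bar>) \<le> 1 / 4"
    unfolding mixing_time_def .
  then have half: "a (i + ?t) \<le> 1 / 2 * a i" for i
    unfolding a_def using x by (intro kernel_pow_L1_contract[where r = \<mu>]) (simp_all add: mult.commute)
  have a0: "0 \<le> a i" for i
    unfolding a_def by (intro sum_nonneg) auto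
  have "(\<Sum>i<n. a i) \<le> (\<Sum>i<?t + n. a i)"
    using a0 by (intro sum_mono2) auto
  also have "\<dots> = (\<Sum>i<?t. a i) + (\<Sum>i<n. a (i + ?t))"
    by (induction n) (simp_all add: add.commute[of _ ?t])
  also have "\<dots> \<le> (\<Sum>i<?t. 2) + (\<Sum>i<n. 1 / 2 * a i)"
    using half kernel_pow_L1_le_2[OF x] unfolding a_def by (intro add_mono sum_mono) auto
  also have "(\<Sum>i<n. 1 / 2 * a i) = 1 / 2 * (\<Sum>i<n. a i)"
    by (simp only: sum_distrib_left)
  finally have "(\<Sum>i<n. a i) \<le> 4 * real ?t"
    by simp
  then show ?thesis
    unfolding a_def .
qed

end

end

section \<open>The state-action chain\<close>

lemma sum_state_action_kernel:
  "(\<Sum>z'\<in>S \<times> A. state_action_kernel \<pi> P z z' * x z') = (\<Sum>s\<in>S. P z s * policy_avg A \<pi> x s)"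
  unfolding state_action_kernel_def policy_avg_def
  by (auto simp: sum.cartesian_product sum_distrib_left mult.assoc intro!: sum.cong)

context
  fixes S :: "'s set" and A :: "'a set" and P :: "'s \<times> 'a \<Rightarrow> 's \<Rightarrow> real" and \<pi> :: "'s \<Rightarrow> 'a \<Rightarrow> real"
  assumes S: "finite S" and A: "finite A" and P: "P \<in> trans_kernels S A" and \<pi>: "\<pi> \<in> policies S A"
begin

lemma trans_kernel_simplex: "z \<in> S \<times> A \<Longrightarrow> P z \<in> prob_simplex S"
  using P by (auto simp: trans_kernels_def)

lemma policy_simplex: "s \<in> S \<Longrightarrow> \<pi> s \<in> prob_simplex A"
  using \<pi> by (auto simp: policies_def)

lemma state_action_kernel_simplex:
  assumes "z \<in> S \<times> A"
  shows "state_action_kernel \<pi> P z \<in> prob_simplex (S \<times> A)"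
proof -
  have "(\<Sum>z'\<in>S \<times> A. state_action_kernel \<pi> P z z') = (\<Sum>s\<in>S. P z s * (\<Sum>a\<in>A. \<pi> s a))"
    using sum_state_action_kernel[where z=z and x="\<lambda>_. 1"] by (simp add: policy_avg_def)
  also have "\<dots> = 1"
    using prob_simplexD(2)[OF policy_simplex] prob_simplexD(2)[OF trans_kernel_simplex[OF assms]] by simp
  finally show ?thesis
    using trans_kernel_simplex[OF assms] policy_simplex
    by (auto simp: prob_simplex_def state_action_kernel_def)
qed

lemma state_kernel_simplex:
  assumes s: "s \<in> S"
  shows "state_kernel A \<pi> P s \<in> prob_simplex S"
proof -
  have P': "P (s, a) \<in> prob_simplex S" if "a \<in> A" for a
    using s that by (intro trans_kernel_simplex) auto
  have "(\<Sum>s'\<in>S. state_kernel A \<pi> P s s') = (\<Sum>a\<in>A. \<pi> s a * (\<Sum>s'\<in>S. P (s, a) s'))"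
    unfolding state_kernel_def by (subst sum.swap) (simp add: sum_distrib_left)
  also have "\<dots> = 1"
    using prob_simplexD(2)[OF P'] prob_simplexD(2)[OF policy_simplex[OF s]] by simp
  finally show ?thesis
    using P' policy_simplex[OF s]
    by (auto simp: prob_simplex_def state_kernel_def intro!: sum_nonneg sum.neutral)
qed

text \<open>Actions are redrawn from \<pi> at every step: after the first transition only the state
  chain moves, and the last action is an independent factor.\<close>

lemma kernel_pow_state_action_Suc:
  assumes "z \<in> S \<times> A" "s' \<in> S" "a' \<in> A"
  shows "kernel_pow (S \<times> A) (state_action_kernel \<pi> P) (Suc n) z (s', a')
    = (\<Sum>s\<in>S. P z s * kernel_pow S (state_kernel A \<pi> P) n s s') * \<pi> s' a'"
  using assms(1)
proof (induction n arbitrary: z)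
  case 0
  have "(\<Sum>z'\<in>S \<times> A. state_action_kernel \<pi> P z z' * (if z' = (s', a') then 1 else 0))
      = (\<Sum>z'\<in>S \<times> A. if z' = (s', a') then state_action_kernel \<pi> P z z' else 0)"
    by (intro sum.cong) auto
  moreover have "(\<Sum>s\<in>S. P z s * (if s = s' then 1 else 0)) = (\<Sum>s\<in>S. if s = s' then P z s else 0)"
    by (intro sum.cong) auto
  ultimately show ?case
    using S A assms by (simp add: state_action_kernel_def)
next
  case (Suc n)
  have "kernel_pow (S \<times> A) (state_action_kernel \<pi> P) (Suc (Suc n)) z (s', a')
      = (\<Sum>z1\<in>S \<times> A. state_action_kernel \<pi> P z z1 *
          ((\<Sum>s\<in>S. P z1 s * kernel_pow S (state_kernel A \<pi> P) n s s') * \<pi> s' a'))"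
    using Suc.IH by (subst kernel_pow.simps) (auto intro!: sum.cong simp del: kernel_pow.simps)
  also have "\<dots> = (\<Sum>s1\<in>S. P z s1 * (\<Sum>a1\<in>A. \<pi> s1 a1 *
          ((\<Sum>s\<in>S. P (s1, a1) s * kernel_pow S (state_kernel A \<pi> P) n s s') * \<pi> s' a')))"
    unfolding sum_state_action_kernel policy_avg_def ..
  also have "\<dots> = (\<Sum>s1\<in>S. P z s1 * (\<Sum>s\<in>S. state_kernel A \<pi> P s1 s * kernel_pow S (state_kernel A \<pi> P) n s s')) * \<pi> s' a'"
  proof -
    have "(\<Sum>a1\<in>A. \<pi> s1 a1 * ((\<Sum>s\<in>S. P (s1, a1) s * kernel_pow S (state_kernel A \<pi> P) n s s') * \<pi> s' a'))
        = (\<Sum>s\<in>S. state_kernel A \<pi> P s1 s * kernel_pow S (state_kernel A \<pi> P) n s s') * \<pi> s' a'" for s1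
      unfolding state_kernel_def[of A \<pi> P s1]
      by (simp add: sum_distrib_left sum_distrib_right mult.assoc) (rule sum.swap)
    then show ?thesis
      by (simp add: sum_distrib_right mult.assoc)
  qed
  finally show ?case by simp
qed

context
  fixes \<nu> :: "'s \<times> 'a \<Rightarrow> real"
  assumes \<nu>: "stationary (S \<times> A) (state_action_kernel \<pi> P) \<nu>"
begin

text \<open>One application of the kernel already produces the factor \<open>\<pi> s a\<close>, so
  stationarity forces \<nu> to be its state marginal times the policy.\<close>

lemma sum_stationary_state_action:
  assumes "s \<in> S"
  shows "(\<Sum>a\<in>A. \<nu> (s, a)) = (\<Sum>z\<in>S \<times> A. \<nu> z * P z s)"
    and "a \<in> A \<Longrightarrow> \<nu> (s, a) = (\<Sum>a\<in>A. \<nu> (s, a)) * \<pi> s a"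
proof -
  have *: "\<nu> (s, a) = (\<Sum>z\<in>S \<times> A. \<nu> z * P z s) * \<pi> s a" if "a \<in> A" for a
    using \<nu> assms that
    by (simp add: stationary_def state_action_kernel_def sum_distrib_right mult.assoc)
  then have "(\<Sum>a\<in>A. \<nu> (s, a)) = (\<Sum>z\<in>S \<times> A. \<nu> z * P z s) * (\<Sum>a\<in>A. \<pi> s a)"
    by (simp add: sum_distrib_left)
  then show **: "(\<Sum>a\<in>A. \<nu> (s, a)) = (\<Sum>z\<in>S \<times> A. \<nu> z * P z s)"
    using prob_simplexD(2)[OF policy_simplex[OF assms]] by simp
  show "\<nu> (s, a) = (\<Sum>a\<in>A. \<nu> (s, a)) * \<pi> s a" if "a \<in> A"
    unfolding ** by (rule *[OF that])
qed

lemma stationary_state_marginal: "stationary S (state_kernel A \<pi> P) (\<lambda>s. \<Sum>a\<in>A. \<nu> (s, a))"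
  unfolding stationary_def
proof (intro conjI ballI)
  have "\<nu> \<in> prob_simplex (S \<times> A)"
    using \<nu> by (simp add: stationary_def)
  then show "(\<lambda>s. \<Sum>a\<in>A. \<nu> (s, a)) \<in> prob_simplex S"
    by (auto simp: prob_simplex_def sum.cartesian_product intro!: sum_nonneg sum.neutral)
next
  fix s' assume s': "s' \<in> S"
  have "(\<Sum>s\<in>S. (\<Sum>a\<in>A. \<nu> (s, a)) * state_kernel A \<pi> P s s')
      = (\<Sum>s\<in>S. \<Sum>a\<in>A. ((\<Sum>a\<in>A. \<nu> (s, a)) * \<pi> s a) * P (s, a) s')"
    by (simp add: state_kernel_def sum_distrib_left mult.assoc)
  also have "\<dots> = (\<Sum>s\<in>S. \<Sum>a\<in>A. \<nu> (s, a) * P (s, a) s')"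
    by (intro sum.cong refl) (simp flip: sum_stationary_state_action(2))
  also have "\<dots> = (\<Sum>a\<in>A. \<nu> (s', a))"
    unfolding sum_stationary_state_action(1)[OF s'] by (simp add: sum.cartesian_product)
  finally show "(\<Sum>s\<in>S. (\<Sum>a\<in>A. \<nu> (s, a)) * state_kernel A \<pi> P s s') = (\<Sum>a\<in>A. \<nu> (s', a))" .
qed

text \<open>Both laws contain the same factor \<open>\<pi> s' a'\<close>, which sums to 1; what
  remains is the distance for the state chain, averaged over the first transition.\<close>

lemma kernel_pow_state_action_L1:
  assumes z: "z \<in> S \<times> A"
  shows "(\<Sum>z'\<in>S \<times> A. \<bar>kernel_pow (S \<times> A) (state_action_kernel \<pi> P) (Suc n) z z' - \<nu> z'\<bar>)
    \<le> (\<Sum>s\<in>S. P z s * (\<Sum>s'\<in>S. \<bar>kernel_pow S (state_kernel A \<pi> P) n s s' - (\<Sum>a\<in>A. \<nu> (s', a))\<bar>))"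
proof -
  let ?D = "\<lambda>s s'. kernel_pow S (state_kernel A \<pi> P) n s s' - (\<Sum>a\<in>A. \<nu> (s', a))"
  note Pz = trans_kernel_simplex[OF z]
  have eq: "kernel_pow (S \<times> A) (state_action_kernel \<pi> P) (Suc n) z (s', a') - \<nu> (s', a')
      = (\<Sum>s\<in>S. P z s * ?D s s') * \<pi> s' a'" if "s' \<in> S" "a' \<in> A" for s' a'
  proof -
    have "(\<Sum>s\<in>S. P z s * ?D s s')
        = (\<Sum>s\<in>S. P z s * kernel_pow S (state_kernel A \<pi> P) n s s') - (\<Sum>s\<in>S. P z s) * (\<Sum>a\<in>A. \<nu> (s', a))"
      by (simp add: right_diff_distrib sum_subtractf sum_distrib_right)
    then show ?thesis
      using sum_stationary_state_action(2)[OF that] prob_simplexD(2)[OF Pz]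
      by (simp add: kernel_pow_state_action_Suc[OF z that] left_diff_distrib del: kernel_pow.simps)
  qed
  have "(\<Sum>z'\<in>S \<times> A. \<bar>kernel_pow (S \<times> A) (state_action_kernel \<pi> P) (Suc n) z z' - \<nu> z'\<bar>)
      = (\<Sum>s'\<in>S. \<Sum>a'\<in>A. \<bar>(\<Sum>s\<in>S. P z s * ?D s s') * \<pi> s' a'\<bar>)"
    unfolding sum.cartesian_product by (intro sum.cong refl) (auto simp: eq simp del: kernel_pow.simps)
  also have "\<dots> = (\<Sum>s'\<in>S. \<bar>\<Sum>s\<in>S. P z s * ?D s s'\<bar> * (\<Sum>a'\<in>A. \<pi> s' a'))"
    using prob_simplexD(1)[OF policy_simplex] by (simp add: abs_mult sum_distrib_left)
  also have "\<dots> = (\<Sum>s'\<in>S. \<bar>\<Sum>s\<in>S. P z s * ?D s s'\<bar>)"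
    using prob_simplexD(2)[OF policy_simplex] by simp
  also have "\<dots> \<le> (\<Sum>s'\<in>S. \<Sum>s\<in>S. P z s * \<bar>?D s s'\<bar>)"
    using prob_simplexD(1)[OF Pz]
    by (intro sum_mono order_trans[OF sum_abs]) (simp add: abs_mult)
  also have "\<dots> = (\<Sum>s\<in>S. P z s * (\<Sum>s'\<in>S. \<bar>?D s s'\<bar>))"
    by (subst sum.swap) (simp add: sum_distrib_left)
  finally show ?thesis .
qed

text \<open>Transfers mixing from the state chain to the chain of pairs. The comparison lags one
  step behind, so the term of index 0 is bounded separately by 2.\<close>

lemma sum_kernel_pow_state_action_L1_le:
  assumes irr: "irreducible_chain S (state_kernel A \<pi> P)" and aper: "aperiodic_chain S (state_kernel A \<pi> P)"
    and z: "z \<in> S \<times> A"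
  shows "(\<Sum>i<n. \<Sum>z'\<in>S \<times> A. \<bar>kernel_pow (S \<times> A) (state_action_kernel \<pi> P) i z z' - \<nu> z'\<bar>)
    \<le> 2 + 4 * real (mixing_time S (state_kernel A \<pi> P) (\<lambda>s. \<Sum>a\<in>A. \<nu> (s, a)))"
proof (cases n)
  case (Suc m)
  let ?D = "\<lambda>i s. \<Sum>s'\<in>S. \<bar>kernel_pow S (state_kernel A \<pi> P) i s s' - (\<Sum>a\<in>A. \<nu> (s', a))\<bar>"
  let ?t = "real (mixing_time S (state_kernel A \<pi> P) (\<lambda>s. \<Sum>a\<in>A. \<nu> (s, a)))"
  note Pz = trans_kernel_simplex[OF z]
  have "(\<Sum>i<m. \<Sum>z'\<in>S \<times> A. \<bar>kernel_pow (S \<times> A) (state_action_kernel \<pi> P) (Suc i) z z' - \<nu> z'\<bar>)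
      \<le> (\<Sum>i<m. \<Sum>s\<in>S. P z s * ?D i s)"
    by (intro sum_mono kernel_pow_state_action_L1 z)
  also have "\<dots> = (\<Sum>s\<in>S. P z s * (\<Sum>i<m. ?D i s))"
    by (subst sum.swap) (simp add: sum_distrib_left)
  also have "\<dots> \<le> (\<Sum>s\<in>S. P z s * (4 * ?t))"
    using prob_simplexD(1)[OF Pz]
    by (intro sum_mono mult_left_mono sum_kernel_pow_L1_le S state_kernel_simplex
        stationary_state_marginal irr aper) auto
  also have "\<dots> = 4 * ?t"
    using prob_simplexD(2)[OF Pz] by (simp flip: sum_distrib_right)
  finally show ?thesis
    using kernel_pow_L1_le_2[OF _ state_action_kernel_simplex \<nu> z, of 0] S A
    unfolding Suc sum.lessThan_Suc_shift by (simp del: kernel_pow.simps)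
qed simp

end

end

section \<open>Bellman equations\<close>

lemma prob_simplex_sum_le:
  assumes "p \<in> prob_simplex X" "\<And>x. x \<in> X \<Longrightarrow> g x \<le> (b :: real)"
  shows "(\<Sum>x\<in>X. p x * g x) \<le> b"
proof -
  have "(\<Sum>x\<in>X. p x * g x) \<le> (\<Sum>x\<in>X. p x * b)"
    using assms prob_simplexD(1)[OF assms(1)] by (intro sum_mono mult_left_mono) auto
  then show ?thesis
    using prob_simplexD(2)[OF assms(1)] by (simp flip: sum_distrib_right)
qed

lemma step_op_le:
  assumes "\<And>z. z \<in> X \<Longrightarrow> K z \<in> prob_simplex X" "\<And>x z. z \<in> X \<Longrightarrow> g x z \<le> b" "z \<in> X"
  shows "step_op X K upd g x z \<le> b"
  unfolding step_op_def using assms by (intro prob_simplex_sum_le) auto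

section \<open>Discounted cost of a finite chain\<close>

context
  fixes X :: "'z set" and K :: "'z \<Rightarrow> 'z \<Rightarrow> real" and c :: "'z \<Rightarrow> real" and \<gamma> :: real
  assumes X: "finite X" and K: "\<And>x. x \<in> X \<Longrightarrow> K x \<in> prob_simplex X"
    and c: "\<And>z. z \<in> X \<Longrightarrow> 0 \<le> c z \<and> c z \<le> 1" and \<gamma>: "0 \<le> \<gamma>" "\<gamma> < 1"
begin

text \<open>The auxiliary variable of \<open>step_op\<close> is trivial here, since the cost depends
  on the present state alone.\<close>

definition expected_cost :: "nat \<Rightarrow> 'z \<Rightarrow> real" where
  "expected_cost t = (step_op X K (\<lambda>_ _ _. ()) ^^ t) (\<lambda>_. c) ()"

lemma expected_cost_bounds:
  assumes "z \<in> X"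
  shows "0 \<le> expected_cost t z" "expected_cost t z \<le> 1"
proof -
  let ?L = "step_op X K (\<lambda>_ _ _. ())"
  have "\<forall>x. \<forall>z\<in>X. 0 \<le> (?L ^^ t) (\<lambda>_. c) x z \<and> (?L ^^ t) (\<lambda>_. c) x z \<le> 1"
  proof (induction t)
    case 0
    then show ?case using c by simp
  next
    case (Suc t)
    then show ?case
      using step_op_nonneg[of X K "(?L ^^ t) (\<lambda>_. c)"] step_op_le[of X K "(?L ^^ t) (\<lambda>_. c)" 1] K by simp
  qed
  then show "0 \<le> expected_cost t z" "expected_cost t z \<le> 1"
    using assms by (simp_all add: expected_cost_def)
qed

lemma expected_cost_Suc: "expected_cost (Suc t) z = (\<Sum>z'\<in>X. K z z' * expected_cost t z')"
  by (simp add: expected_cost_def step_op_def)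

lemma summable_expected_cost: "z \<in> X \<Longrightarrow> summable (\<lambda>t. \<gamma> ^ t * expected_cost t z)"
  using \<gamma> expected_cost_bounds
  by (intro summable_comparison_test'[OF summable_geometric, of \<gamma> 0]) (simp_all add: abs_mult mult_left_le)

text \<open>Costs lie in \<open>[0, 1]\<close>, so the series is dominated by the geometric one and
  may be exchanged with the expectation.\<close>

lemma discounted_cost_series:
  assumes z: "z \<in> X"
  shows "(LINT \<omega>|chain_law X (\<lambda>z'. if z' = z then 1 else 0) K. (\<Sum>t. \<gamma> ^ t * c (\<omega> t)))
    = (\<Sum>t. \<gamma> ^ t * expected_cost t z)"
proof -
  let ?M = "chain_law X (\<lambda>z'. if z' = z then 1 else 0) K"
  have \<mu>: "(\<lambda>z'. if z' = z then 1 else 0) \<in> prob_simplex X"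
    using z X by (auto simp: prob_simplex_def)
  note run = integral_chain_law_run[where K = K and g = "\<lambda>_::unit. c" and upd = "\<lambda>_ _ _. ()" and x = "()", OF X \<mu> K]
  have I: "integrable ?M (\<lambda>\<omega>. c (\<omega> t))" for t
    using c by (intro run(2)) auto
  have E: "(LINT \<omega>|?M. c (\<omega> t)) = expected_cost t z" for t
  proof -
    have "(LINT \<omega>|?M. c (\<omega> t)) = (\<Sum>z'\<in>X. (if z' = z then 1 else 0) * expected_cost t z')"
      unfolding expected_cost_def using c by (intro run(1)) auto
    also have "\<dots> = (\<Sum>z'\<in>X. if z' = z then expected_cost t z' else 0)"
      by (intro sum.cong) auto
    finally show ?thesis using X z by simp
  qed
  have space: "\<omega> t \<in> X" if "\<omega> \<in> space ?M" for \<omega> t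
    using that space_chain_law[OF X \<mu> K] by auto
  have norm: "(LINT \<omega>|?M. norm (\<gamma> ^ t * c (\<omega> t))) = \<gamma> ^ t * expected_cost t z" for t
  proof -
    have "(LINT \<omega>|?M. norm (\<gamma> ^ t * c (\<omega> t))) = (LINT \<omega>|?M. \<gamma> ^ t * c (\<omega> t))"
      using c space \<gamma> by (intro Bochner_Integration.integral_cong) (auto simp: abs_mult)
    then show ?thesis by (simp add: E)
  qed
  have "(LINT \<omega>|?M. (\<Sum>t. \<gamma> ^ t * c (\<omega> t))) = (\<Sum>t. LINT \<omega>|?M. \<gamma> ^ t * c (\<omega> t))"
  proof (rule integral_suminf)
    show "AE \<omega> in ?M. summable (\<lambda>t. norm (\<gamma> ^ t * c (\<omega> t)))"
    proof (rule AE_I2)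
      fix \<omega> assume "\<omega> \<in> space ?M"
      then show "summable (\<lambda>t. norm (\<gamma> ^ t * c (\<omega> t)))"
        using c space \<gamma>
        by (intro summable_comparison_test'[OF summable_geometric, of \<gamma> 0]) (simp_all add: abs_mult mult_left_le)
    qed
    show "summable (\<lambda>t. LINT \<omega>|?M. norm (\<gamma> ^ t * c (\<omega> t)))"
      unfolding norm by (rule summable_expected_cost[OF z])
  qed (use I in auto)
  then show ?thesis by (simp add: E)
qed

lemma discounted_series_Bellman:
  assumes z: "z \<in> X"
  shows "(\<Sum>t. \<gamma> ^ t * expected_cost t z)
    = c z + \<gamma> * (\<Sum>z'\<in>X. K z z' * (\<Sum>t. \<gamma> ^ t * expected_cost t z'))"
proof -
  have "(\<Sum>t. \<gamma> ^ t * expected_cost t z) = c z + (\<Sum>t. \<gamma> ^ Suc t * expected_cost (Suc t) z)"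
    using suminf_split_head[OF summable_expected_cost[OF z]] by (simp add: expected_cost_def)
  also have "(\<Sum>t. \<gamma> ^ Suc t * expected_cost (Suc t) z)
      = (\<Sum>t. \<Sum>z'\<in>X. \<gamma> * K z z' * (\<gamma> ^ t * expected_cost t z'))"
    by (simp add: expected_cost_Suc sum_distrib_left algebra_simps)
  also have "\<dots> = (\<Sum>z'\<in>X. \<Sum>t. \<gamma> * K z z' * (\<gamma> ^ t * expected_cost t z'))"
    by (intro suminf_sum summable_mult summable_expected_cost)
  also have "\<dots> = (\<Sum>z'\<in>X. \<gamma> * K z z' * (\<Sum>t. \<gamma> ^ t * expected_cost t z'))"
    by (intro sum.cong refl suminf_mult summable_expected_cost)
  finally show ?thesis
    by (simp add: sum_distrib_left mult.assoc)
qed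

lemma discounted_series_bounds:
  assumes z: "z \<in> X"
  shows "0 \<le> (\<Sum>t. \<gamma> ^ t * expected_cost t z)" "(\<Sum>t. \<gamma> ^ t * expected_cost t z) \<le> 1 / (1 - \<gamma>)"
proof -
  show "0 \<le> (\<Sum>t. \<gamma> ^ t * expected_cost t z)"
    using \<gamma> expected_cost_bounds[OF z] by (intro suminf_nonneg summable_expected_cost z) auto
  have "(\<Sum>t. \<gamma> ^ t * expected_cost t z) \<le> (\<Sum>t. \<gamma> ^ t)"
    using \<gamma> expected_cost_bounds[OF z]
    by (intro suminf_le summable_expected_cost z summable_geometric) (auto intro!: mult_left_le)
  also have "\<dots> = 1 / (1 - \<gamma>)"
    using \<gamma> by (intro suminf_geometric) auto
  finally show "(\<Sum>t. \<gamma> ^ t * expected_cost t z) \<le> 1 / (1 - \<gamma>)" .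
qed

end

lemma Q_value_Bellman:
  assumes S: "finite S" and A: "finite A" and P: "P \<in> trans_kernels S A" and \<pi>: "\<pi> \<in> policies S A"
    and c: "\<And>z. z \<in> S \<times> A \<Longrightarrow> 0 \<le> c z \<and> c z \<le> 1" and \<gamma>: "0 \<le> \<gamma>" "\<gamma> < 1" and z: "z \<in> S \<times> A"
  shows "Q_value S A c \<gamma> P \<pi> z = c z + \<gamma> * (\<Sum>s\<in>S. P z s * policy_avg A \<pi> (Q_value S A c \<gamma> P \<pi>) s)"
    and "0 \<le> Q_value S A c \<gamma> P \<pi> z" and "Q_value S A c \<gamma> P \<pi> z \<le> 1 / (1 - \<gamma>)"
proof -
  have X: "finite (S \<times> A)" using S A by simp
  note K = state_action_kernel_simplex[OF S A P \<pi>]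
  note eq = discounted_cost_series[where K = "state_action_kernel \<pi> P" and X = "S \<times> A" and c = c, OF X K c \<gamma>, folded Q_value_def]
  have "Q_value S A c \<gamma> P \<pi> z = c z + \<gamma> * (\<Sum>z'\<in>S \<times> A. state_action_kernel \<pi> P z z' * Q_value S A c \<gamma> P \<pi> z')"
    using discounted_series_Bellman[where K = "state_action_kernel \<pi> P" and c = c, OF X K c \<gamma> z] z by (simp add: eq)
  then show "Q_value S A c \<gamma> P \<pi> z = c z + \<gamma> * (\<Sum>s\<in>S. P z s * policy_avg A \<pi> (Q_value S A c \<gamma> P \<pi>) s)"
    by (simp only: sum_state_action_kernel)
  show "0 \<le> Q_value S A c \<gamma> P \<pi> z" "Q_value S A c \<gamma> P \<pi> z \<le> 1 / (1 - \<gamma>)"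
    using discounted_series_bounds[where K = "state_action_kernel \<pi> P" and c = c, OF X K c \<gamma> z] z by (simp_all add: eq)
qed

section \<open>The robust Bellman operator and its fixed point\<close>

lemma policy_avg_le:
  assumes "\<pi> \<in> policies S A" "s \<in> S" "\<And>z. z \<in> S \<times> A \<Longrightarrow> x z \<le> y z + m"
  shows "policy_avg A \<pi> x s \<le> policy_avg A \<pi> y s + m"
proof -
  have "\<pi> s \<in> prob_simplex A"
    using assms by (simp add: policies_def)
  then have "(\<Sum>a\<in>A. \<pi> s a * (x (s, a) - y (s, a))) \<le> m"
    using assms by (intro prob_simplex_sum_le) (auto simp: algebra_simps)
  then show ?thesis
    by (simp add: policy_avg_def right_diff_distrib sum_subtractf)
qed

text \<open>The bracket is the supremum over \<open>u \<in> U\<close> of the mean under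
  \<open>perturbed_kernel PN u\<close>, by \<open>perturbed_le_support\<close> and
  \<open>support_le\<close>. The nominal mean is kept apart because it is the part that is
  sampled.\<close>

definition robust_bellman ::
  "'s set \<Rightarrow> 'a set \<Rightarrow> ('s \<times> 'a \<Rightarrow> real) \<Rightarrow> real \<Rightarrow> ('s \<times> 'a \<Rightarrow> 's \<Rightarrow> real)
    \<Rightarrow> ('s \<times> 'a \<Rightarrow> 's \<Rightarrow> real) set \<Rightarrow> ('s \<Rightarrow> 'a \<Rightarrow> real) \<Rightarrow> ('s \<times> 'a \<Rightarrow> real) \<Rightarrow> 's \<times> 'a \<Rightarrow> real"
  where
  "robust_bellman S A c \<gamma> PN U \<pi> x z = c z + \<gamma> * ((\<Sum>s\<in>S. PN z s * policy_avg A \<pi> x s)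
     + support_fun S (marginal_set U z) (policy_avg A \<pi> x))"

context robust_mdp
begin

lemma perturbed_simplex:
  assumes "z \<in> S \<times> A" "u \<in> U"
  shows "perturbed_kernel PN u z \<in> prob_simplex S"
  using U_kernel[OF assms(2)] assms(1) unfolding trans_kernels_def by blast

lemma prob_simplex_sum_le_abs: "p \<in> prob_simplex S \<Longrightarrow> (\<Sum>s\<in>S. p s * v s) \<le> (\<Sum>s\<in>S. \<bar>v s\<bar>)"
  using S(1) by (elim prob_simplex_sum_le) (rule order_trans[OF abs_ge_self]; rule member_le_sum; simp)

lemma sum_perturbed:
  "(\<Sum>s\<in>S. perturbed_kernel PN u z s * v s) = (\<Sum>s\<in>S. PN z s * v s) + (\<Sum>s\<in>S. u z s * v s)"
  by (simp add: perturbed_kernel_def distrib_right sum.distrib)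

lemma bdd_above_marginal:
  assumes "z \<in> S \<times> A"
  shows "bdd_above ((\<lambda>p. \<Sum>s\<in>S. p s * v s) ` marginal_set U z)"
proof (rule bdd_aboveI2)
  fix p assume "p \<in> marginal_set U z"
  then obtain u where "u \<in> U" "p = u z" by (auto simp: marginal_set_def)
  then show "(\<Sum>s\<in>S. p s * v s) \<le> (\<Sum>s\<in>S. \<bar>v s\<bar>) - (\<Sum>s\<in>S. PN z s * v s)"
    using prob_simplex_sum_le_abs[OF perturbed_simplex[OF assms, of u], of v]
    by (simp add: sum_perturbed)
qed

lemma perturbed_le_support:
  assumes "z \<in> S \<times> A" "u \<in> U"
  shows "(\<Sum>s\<in>S. perturbed_kernel PN u z s * v s)
    \<le> (\<Sum>s\<in>S. PN z s * v s) + support_fun S (marginal_set U z) v"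
  unfolding sum_perturbed support_fun_def
  using assms(2) by (intro add_left_mono cSUP_upper bdd_above_marginal assms(1)) (auto simp: marginal_set_def)

lemma support_le:
  assumes "z \<in> S \<times> A" "\<And>u. u \<in> U \<Longrightarrow> (\<Sum>s\<in>S. perturbed_kernel PN u z s * v s) \<le> m"
  shows "(\<Sum>s\<in>S. PN z s * v s) + support_fun S (marginal_set U z) v \<le> m"
proof -
  have "support_fun S (marginal_set U z) v \<le> m - (\<Sum>s\<in>S. PN z s * v s)"
    unfolding support_fun_def
  proof (rule cSUP_least)
    fix p assume "p \<in> marginal_set U z"
    then obtain u where "u \<in> U" "p = u z" by (auto simp: marginal_set_def)
    then show "(\<Sum>s\<in>S. p s * v s) \<le> m - (\<Sum>s\<in>S. PN z s * v s)"
      using assms(2)[of u] by (simp add: sum_perturbed)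
  qed (use U_nonempty in \<open>simp add: marginal_set_def\<close>)
  then show ?thesis by simp
qed

text \<open>One-sided form of monotonicity and contraction together: every perturbed row is a
  probability vector, so a shift by \<open>m\<close> passes through each mean and then through the
  supremum. Used in both directions it gives the Lipschitz bound.\<close>

lemma robust_bellman_le:
  assumes \<pi>: "\<pi> \<in> policies S A" and z: "z \<in> S \<times> A" and le: "\<And>z. z \<in> S \<times> A \<Longrightarrow> x z \<le> y z + m"
  shows "robust_bellman S A c \<gamma> PN U \<pi> x z \<le> robust_bellman S A c \<gamma> PN U \<pi> y z + \<gamma> * m"
proof -
  have le': "(\<Sum>s\<in>S. PN z s * policy_avg A \<pi> x s) + support_fun S (marginal_set U z) (policy_avg A \<pi> x)
    \<le> ((\<Sum>s\<in>S. PN z s * policy_avg A \<pi> y s) + support_fun S (marginal_set U z) (policy_avg A \<pi> y)) + m"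
  proof (rule support_le[OF z])
    fix u assume u: "u \<in> U"
    note p = perturbed_simplex[OF z u]
    have "(\<Sum>s\<in>S. perturbed_kernel PN u z s * (policy_avg A \<pi> x s - policy_avg A \<pi> y s)) \<le> m"
      using policy_avg_le[where x = x and y = y and m = m, OF \<pi> _ le]
      by (intro prob_simplex_sum_le[OF p]) (simp add: algebra_simps)
    then have "(\<Sum>s\<in>S. perturbed_kernel PN u z s * policy_avg A \<pi> x s)
        \<le> (\<Sum>s\<in>S. perturbed_kernel PN u z s * policy_avg A \<pi> y s) + m"
      by (simp add: right_diff_distrib sum_subtractf)
    with perturbed_le_support[OF z u, of "policy_avg A \<pi> y"]
    show "(\<Sum>s\<in>S. perturbed_kernel PN u z s * policy_avg A \<pi> x s)
      \<le> (\<Sum>s\<in>S. PN z s * policy_avg A \<pi> y s) + support_fun S (marginal_set U z) (policy_avg A \<pi> y) + m"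
      by simp
  qed
  show ?thesis
    unfolding robust_bellman_def using mult_left_mono[OF le' less_imp_le[OF discount(1)]]
    by (simp add: distrib_left)
qed

lemma Q_value_perturbed:
  assumes "\<pi> \<in> policies S A" "u \<in> U" "z \<in> S \<times> A"
  shows "Q_value S A c \<gamma> (perturbed_kernel PN u) \<pi> z = c z + \<gamma> * (\<Sum>s\<in>S. perturbed_kernel PN u z s
      * policy_avg A \<pi> (Q_value S A c \<gamma> (perturbed_kernel PN u) \<pi>) s)"
    and "0 \<le> Q_value S A c \<gamma> (perturbed_kernel PN u) \<pi> z"
    and "Q_value S A c \<gamma> (perturbed_kernel PN u) \<pi> z \<le> 1 / (1 - \<gamma>)"
  using Q_value_Bellman[OF S(1) A(1) U_kernel[OF assms(2)] assms(1) _ _ _ assms(3), of c \<gamma>] cost discount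
  by (auto simp: less_imp_le)

lemma Q_value_le_robust:
  assumes "\<pi> \<in> policies S A" "u \<in> U" "z \<in> S \<times> A"
  shows "Q_value S A c \<gamma> (perturbed_kernel PN u) \<pi> z \<le> Q_robust S A c \<gamma> PN U \<pi> z"
  unfolding Q_robust_def using assms Q_value_perturbed(3)
  by (intro cSUP_upper bdd_aboveI2[where M = "1 / (1 - \<gamma>)"]) auto

lemma Q_robust_bounds:
  assumes "\<pi> \<in> policies S A" "z \<in> S \<times> A"
  shows "0 \<le> Q_robust S A c \<gamma> PN U \<pi> z" "Q_robust S A c \<gamma> PN U \<pi> z \<le> 1 / (1 - \<gamma>)"
proof -
  obtain u where "u \<in> U" using U_nonempty by auto
  then show "0 \<le> Q_robust S A c \<gamma> PN U \<pi> z"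
    using Q_value_perturbed(2) Q_value_le_robust assms by (meson order_trans)
  show "Q_robust S A c \<gamma> PN U \<pi> z \<le> 1 / (1 - \<gamma>)"
    unfolding Q_robust_def using Q_value_perturbed(3) assms U_nonempty by (intro cSUP_least) auto
qed

text \<open>A subsolution of the Bellman equation up to an error \<delta>: the largest difference
  \<open>m\<close> between \<open>x\<close> and the value satisfies
  \<open>m \<le> \<gamma> m + \<delta>\<close>.\<close>

lemma le_Q_value:
  assumes \<pi>: "\<pi> \<in> policies S A" and u: "u \<in> U" and z: "z \<in> S \<times> A"
    and le: "\<And>z. z \<in> S \<times> A \<Longrightarrow>
      x z \<le> c z + \<gamma> * (\<Sum>s\<in>S. perturbed_kernel PN u z s * policy_avg A \<pi> x s) + \<delta>"
  shows "x z \<le> Q_value S A c \<gamma> (perturbed_kernel PN u) \<pi> z + \<delta> / (1 - \<gamma>)"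
proof -
  let ?Q = "Q_value S A c \<gamma> (perturbed_kernel PN u) \<pi>"
  define m where "m = Max ((\<lambda>z. x z - ?Q z) ` (S \<times> A))"
  have m: "x z - ?Q z \<le> m" if "z \<in> S \<times> A" for z
    unfolding m_def using S A that by (intro Max_ge) auto
  have "x z - ?Q z \<le> \<gamma> * m + \<delta>" if z: "z \<in> S \<times> A" for z
  proof -
    have "(\<Sum>s\<in>S. perturbed_kernel PN u z s * (policy_avg A \<pi> x s - policy_avg A \<pi> ?Q s)) \<le> m"
      using policy_avg_le[where x = x and y = ?Q and m = m, OF \<pi>] m
      by (intro prob_simplex_sum_le[OF perturbed_simplex[OF z u]]) (simp add: algebra_simps)
    then have "\<gamma> * (\<Sum>s\<in>S. perturbed_kernel PN u z s * (policy_avg A \<pi> x s - policy_avg A \<pi> ?Q s)) \<le> \<gamma> * m"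
      using discount by (intro mult_left_mono) auto
    then show ?thesis
      using le[OF z] Q_value_perturbed(1)[OF \<pi> u z] by (simp add: right_diff_distrib sum_subtractf)
  qed
  moreover have "m \<in> (\<lambda>z. x z - ?Q z) ` (S \<times> A)"
    unfolding m_def using S A by (intro Max_in) auto
  ultimately have "m \<le> \<gamma> * m + \<delta>" by auto
  then have "m \<le> \<delta> / (1 - \<gamma>)"
    using discount by (simp add: field_simps)
  with m[OF z] show ?thesis by simp
qed

text \<open>One inequality follows from the Bellman equation of each fixed \<open>u\<close>. For the
  other, rectangularity joins nearly optimal rows into a single \<open>u\<close>; for it the robust
  value is an approximate subsolution, so the value of \<open>u\<close> is close to the robust value
  at all pairs at once.\<close>

lemma Q_robust_fixed_point:
  assumes \<pi>: "\<pi> \<in> policies S A" and z: "z \<in> S \<times> A"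
  shows "robust_bellman S A c \<gamma> PN U \<pi> (Q_robust S A c \<gamma> PN U \<pi>) z = Q_robust S A c \<gamma> PN U \<pi> z"
proof -
  let ?Q = "Q_robust S A c \<gamma> PN U \<pi>" and ?G = "robust_bellman S A c \<gamma> PN U \<pi>"
  have sub: "?Q z \<le> ?G ?Q z" if z: "z \<in> S \<times> A" for z
    unfolding Q_robust_def[of S A c \<gamma> PN U \<pi> z]
  proof (rule cSUP_least[OF U_nonempty])
    fix u assume u: "u \<in> U"
    let ?Qu = "Q_value S A c \<gamma> (perturbed_kernel PN u) \<pi>"
    have "(\<Sum>s\<in>S. perturbed_kernel PN u z s * policy_avg A \<pi> ?Qu s)
        \<le> (\<Sum>s\<in>S. perturbed_kernel PN u z s * policy_avg A \<pi> ?Q s)"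
      using policy_avg_le[where x = ?Qu and y = ?Q and m = 0, OF \<pi>] Q_value_le_robust[OF \<pi> u]
        prob_simplexD(1)[OF perturbed_simplex[OF z u]]
      by (intro sum_mono mult_left_mono) auto
    also have "\<dots> \<le> (\<Sum>s\<in>S. PN z s * policy_avg A \<pi> ?Q s) + support_fun S (marginal_set U z) (policy_avg A \<pi> ?Q)"
      by (rule perturbed_le_support[OF z u])
    finally show "?Qu z \<le> ?G ?Q z"
      unfolding Q_value_perturbed(1)[OF \<pi> u z] robust_bellman_def using discount by simp
  qed
  moreover have "?G ?Q z \<le> ?Q z"
  proof (rule field_le_epsilon)
    fix e :: real assume e: "0 < e"
    \<comment> \<open>With this choice \<open>le_Q_value\<close> loses exactly \<open>e\<close>, and
      \<open>\<gamma> * e + \<delta> = e\<close> in the final estimate.\<close>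
    define \<delta> where "\<delta> = e * (1 - \<gamma>)"
    have \<delta>: "0 < \<delta>" using e discount by (simp add: \<delta>_def)
    have "\<exists>p. p \<in> marginal_set U z \<and> ?G ?Q z \<le> c z + \<gamma> * (\<Sum>s\<in>S. (PN z s + p s) * policy_avg A \<pi> ?Q s) + \<delta>"
      if z: "z \<in> S \<times> A" for z
    proof -
      have ne: "marginal_set U z \<noteq> {}" using U_nonempty by (auto simp: marginal_set_def)
      have "support_fun S (marginal_set U z) (policy_avg A \<pi> ?Q) - \<delta>
          < (SUP p\<in>marginal_set U z. \<Sum>s\<in>S. p s * policy_avg A \<pi> ?Q s)"
        using \<delta> by (simp add: support_fun_def)
      then obtain p where p: "p \<in> marginal_set U z"
        "support_fun S (marginal_set U z) (policy_avg A \<pi> ?Q) - \<delta> < (\<Sum>s\<in>S. p s * policy_avg A \<pi> ?Q s)"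
        unfolding less_cSUP_iff[OF ne bdd_above_marginal[OF z]] by blast
      have "\<gamma> * support_fun S (marginal_set U z) (policy_avg A \<pi> ?Q) \<le> \<gamma> * ((\<Sum>s\<in>S. p s * policy_avg A \<pi> ?Q s) + \<delta>)"
        using p(2) discount by (intro mult_left_mono) auto
      moreover have "\<gamma> * \<delta> \<le> \<delta>" using \<delta> discount by simp
      ultimately show ?thesis
        using p(1)
        by (intro exI[of _ p]) (simp_all add: robust_bellman_def distrib_right sum.distrib distrib_left)
    qed
    then have "\<forall>z\<in>S \<times> A. \<exists>p. p \<in> marginal_set U z \<and>
        ?G ?Q z \<le> c z + \<gamma> * (\<Sum>s\<in>S. (PN z s + p s) * policy_avg A \<pi> ?Q s) + \<delta>"
      by (rule ballI)
    from bchoice[OF this] obtain p where p: "\<forall>z\<in>S \<times> A. p z \<in> marginal_set U z \<and>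
        ?G ?Q z \<le> c z + \<gamma> * (\<Sum>s\<in>S. (PN z s + p z s) * policy_avg A \<pi> ?Q s) + \<delta>" ..
    \<comment> \<open>Rectangularity enters here: rows chosen separately for each pair form an
      element of \<open>U\<close>.\<close>
    define u where "u z = (if z \<in> S \<times> A then p z else (\<lambda>_. 0))" for z
    have u: "u \<in> U"
      by (subst U_rectangular) (use p in \<open>simp add: u_def\<close>)
    have Gu: "?G ?Q z \<le> c z + \<gamma> * (\<Sum>s\<in>S. perturbed_kernel PN u z s * policy_avg A \<pi> ?Q s) + \<delta>"
      if "z \<in> S \<times> A" for z
      using bspec[OF p that] that by (simp add: perturbed_kernel_def u_def)
    let ?Qu = "Q_value S A c \<gamma> (perturbed_kernel PN u) \<pi>"
    have near: "?Q z \<le> ?Qu z + e" if "z \<in> S \<times> A" for z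
    proof -
      have "?Q z \<le> ?Qu z + \<delta> / (1 - \<gamma>)"
        using order_trans[OF sub Gu] by (rule le_Q_value[OF \<pi> u that])
      then show ?thesis using discount by (simp add: \<delta>_def)
    qed
    have "(\<Sum>s\<in>S. perturbed_kernel PN u z s * (policy_avg A \<pi> ?Q s - policy_avg A \<pi> ?Qu s)) \<le> e"
      using policy_avg_le[where x = ?Q and y = ?Qu and m = e, OF \<pi>] near
      by (intro prob_simplex_sum_le[OF perturbed_simplex[OF z u]]) (simp add: algebra_simps)
    then have "\<gamma> * (\<Sum>s\<in>S. perturbed_kernel PN u z s * (policy_avg A \<pi> ?Q s - policy_avg A \<pi> ?Qu s)) \<le> \<gamma> * e"
      using discount by (intro mult_left_mono) auto
    then have "?G ?Q z \<le> ?Qu z + \<gamma> * e + \<delta>"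
      using Gu[OF z] Q_value_perturbed(1)[OF \<pi> u z] by (simp add: right_diff_distrib sum_subtractf)
    also have "\<dots> = ?Qu z + e"
      by (simp add: \<delta>_def algebra_simps)
    also have "\<dots> \<le> ?Q z + e"
      using Q_value_le_robust[OF \<pi> u z] by simp
    finally show "?G ?Q z \<le> ?Q z + e" .
  qed
  ultimately show ?thesis using z by (intro antisym) simp_all
qed

text \<open>The supremum commutes with the increasing affine map
  \<open>h \<mapsto> \<epsilon>c * (h - ?P)\<close>. The lower bound divides by
  \<epsilon>\<open>c\<close>, so the value 0, where both sides vanish, is treated apart.\<close>

lemma support_contamination:
  assumes con: "contamination_form S A PN U \<epsilon>c QQ" and z: "z \<in> S \<times> A"
  shows "support_fun S (marginal_set U z) v = \<epsilon>c * (support_fun S (QQ z) v - (\<Sum>s\<in>S. PN z s * v s))"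
proof -
  let ?h = "\<lambda>q. \<Sum>s\<in>S. q s * v s" and ?P = "\<Sum>s\<in>S. PN z s * v s"
  have \<epsilon>: "0 \<le> \<epsilon>c" and QQ: "QQ z \<subseteq> prob_simplex S"
    and M: "marginal_set U z = (\<lambda>q s'. \<epsilon>c * (q s' - PN z s')) ` QQ z"
    using con z by (auto simp: contamination_form_def)
  have ne: "QQ z \<noteq> {}"
    using M U_nonempty by (auto simp: marginal_set_def)
  have bdd: "bdd_above (?h ` QQ z)"
    using QQ prob_simplex_sum_le_abs by (intro bdd_aboveI2) auto
  have sup: "support_fun S (marginal_set U z) v = (SUP q\<in>QQ z. \<epsilon>c * (?h q - ?P))"
    unfolding support_fun_def M image_image
    by (intro SUP_cong refl) (simp add: left_diff_distrib sum_subtractf mult.assoc flip: sum_distrib_left)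
  show ?thesis
  proof (rule antisym)
    show "support_fun S (marginal_set U z) v \<le> \<epsilon>c * (support_fun S (QQ z) v - ?P)"
      unfolding sup unfolding support_fun_def using \<epsilon>
      by (intro cSUP_least ne mult_left_mono diff_right_mono cSUP_upper bdd) auto
    have bdd': "bdd_above ((\<lambda>q. \<epsilon>c * (?h q - ?P)) ` QQ z)"
      by (rule bdd_aboveI2[where M = "\<epsilon>c * ((SUP q\<in>QQ z. ?h q) - ?P)"])
         (intro mult_left_mono diff_right_mono cSUP_upper bdd \<epsilon>)
    show "\<epsilon>c * (support_fun S (QQ z) v - ?P) \<le> support_fun S (marginal_set U z) v"
    proof (cases "\<epsilon>c = 0")
      case True
      then show ?thesis using ne by (simp add: sup)
    next
      case False
      then have pos: "0 < \<epsilon>c" using \<epsilon> by simp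
      have "support_fun S (QQ z) v \<le> support_fun S (marginal_set U z) v / \<epsilon>c + ?P"
        unfolding support_fun_def[of S "QQ z"]
      proof (rule cSUP_least[OF ne])
        fix q assume "q \<in> QQ z"
        then have "\<epsilon>c * (?h q - ?P) \<le> support_fun S (marginal_set U z) v"
          unfolding sup by (intro cSUP_upper bdd')
        then show "?h q \<le> support_fun S (marginal_set U z) v / \<epsilon>c + ?P"
          using pos by (simp add: field_simps)
      qed
      then show ?thesis using pos by (simp add: field_simps)
    qed
  qed
qed

text \<open>Both operators are the exact Bellman step plus a multiple of a term whose conditional
  mean is 0. The multiple \<kappa> is \<gamma> for known \<open>U\<close> and
  \<open>\<gamma> * (1 - \<epsilon>c)\<close> under contamination, where the support function
  restores the rest of the nominal mean.\<close>

lemma rtd_operator_form: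
  assumes f: "rtd_operator S A c \<gamma> PN U \<pi> f"
  obtains \<kappa> where "0 \<le> \<kappa>" "\<kappa> \<le> 1"
    "\<And>x z z' y. z \<in> S \<times> A \<Longrightarrow> f x (z, z') y = x y + (robust_bellman S A c \<gamma> PN U \<pi> x z - x z
      + \<kappa> * (x z' - (\<Sum>z''\<in>S \<times> A. state_action_kernel \<pi> PN z z'' * x z''))) * basis_vec z y"
proof -
  consider "f = td_known S A c \<gamma> U \<pi>"
    | \<epsilon>c QQ where "contamination_form S A PN U \<epsilon>c QQ" "f = td_contaminated S A c \<gamma> \<epsilon>c QQ \<pi>"
    using f by (auto simp: rtd_operator_def)
  then show thesis
  proof cases
    case 1
    show ?thesis
    proof (rule that[of \<gamma>])
      fix x z z' y
      show "f x (z, z') y = x y + (robust_bellman S A c \<gamma> PN U \<pi> x z - x z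
          + \<gamma> * (x z' - (\<Sum>z''\<in>S \<times> A. state_action_kernel \<pi> PN z z'' * x z''))) * basis_vec z y"
        unfolding 1 td_known_def robust_bellman_def sum_state_action_kernel by (simp add: algebra_simps)
    qed (use discount in auto)
  next
    case (2 \<epsilon>c QQ)
    have "0 \<le> \<epsilon>c" "\<epsilon>c \<le> 1" using 2 by (auto simp: contamination_form_def)
    then have "0 \<le> \<gamma> * (1 - \<epsilon>c)" "\<gamma> * (1 - \<epsilon>c) \<le> 1"
      using discount mult_le_one[of \<gamma> "1 - \<epsilon>c"] by auto
    then show ?thesis
    proof (rule that)
      fix x z z' y assume z: "z \<in> S \<times> A"
      show "f x (z, z') y = x y + (robust_bellman S A c \<gamma> PN U \<pi> x z - x z + \<gamma> * (1 - \<epsilon>c)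
          * (x z' - (\<Sum>z''\<in>S \<times> A. state_action_kernel \<pi> PN z z'' * x z''))) * basis_vec z y"
        unfolding 2(2) td_contaminated_def robust_bellman_def sum_state_action_kernel support_contamination[OF 2(1) z]
        by (simp add: algebra_simps)
    qed
  qed
qed

end

section \<open>One block of temporal difference steps\<close>

text \<open>Verification by a supermartingale \<open>h\<close> that need only decrease on states
  satisfying the invariant \<open>I\<close>. The induction runs over the number \<open>k\<close> of
  remaining steps.\<close>

lemma step_op_funpow_le:
  assumes K: "\<And>z. z \<in> X \<Longrightarrow> K z \<in> prob_simplex X"
    and inv: "\<And>j x z z'. \<lbrakk>j < N; I j x; z \<in> X; z' \<in> X\<rbrakk> \<Longrightarrow> I (Suc j) (upd x z z')"
    and drift: "\<And>j x z. \<lbrakk>j < N; I j x; z \<in> X\<rbrakk> \<Longrightarrow> step_op X K upd (h (Suc j)) x z \<le> h j x z"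
    and final: "\<And>x z. \<lbrakk>I N x; z \<in> X\<rbrakk> \<Longrightarrow> g x z \<le> h N x z"
    and "I 0 x" "z \<in> X"
  shows "(step_op X K upd ^^ N) g x z \<le> h 0 x z"
proof -
  have "I (N - k) x \<Longrightarrow> z \<in> X \<Longrightarrow> (step_op X K upd ^^ k) g x z \<le> h (N - k) x z" if "k \<le> N" for k x z
    using that
  proof (induction k arbitrary: x z)
    case (Suc k)
    have j: "Suc (N - Suc k) = N - k" "N - Suc k < N" using Suc.prems by auto
    have "(step_op X K upd ^^ Suc k) g x z \<le> step_op X K upd (h (N - k)) x z"
      unfolding funpow.simps comp_def step_op_def[of X K upd _ x z]
      using Suc inv[of "N - Suc k" x z] prob_simplexD(1)[OF K] j
      by (intro sum_mono mult_left_mono) auto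
    also have "\<dots> \<le> h (N - Suc k) x z"
      using drift[of "N - Suc k" x z] Suc.prems j by simp
    finally show ?case .
  qed (use final in auto)
  from this[of N x z] assms show ?thesis by simp
qed

text \<open>If \<open>p x\<close> evolves autonomously, bookkeeping variables can be carried along
  without changing expectations that depend on \<open>p x\<close>.\<close>

lemma step_op_funpow_project:
  assumes "\<And>x z z'. p (upd x z z') = upd' (p x) z z'"
  shows "(step_op X K upd ^^ n) (\<lambda>x. g (p x)) x z = (step_op X K upd' ^^ n) g (p x) z"
  by (induction n arbitrary: x z) (simp_all add: step_op_def assms)

lemma abs_le_square_mean:
  fixes a :: "'z \<Rightarrow> real"
  assumes "finite X" "y \<in> X" "0 < s"
  shows "\<bar>a y\<bar> \<le> ((\<Sum>y\<in>X. (a y)\<^sup>2) / s + s) / 2"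
proof -
  have "2 * \<bar>a y\<bar> * s \<le> (a y)\<^sup>2 + s\<^sup>2"
    using sum_squares_bound[of "\<bar>a y\<bar>" s] by simp
  also have "\<dots> \<le> (\<Sum>y\<in>X. (a y)\<^sup>2) + s\<^sup>2"
    using assms by (intro add_right_mono member_le_sum) auto
  finally show ?thesis
    using assms(3) by (simp add: field_simps power2_eq_square)
qed

section \<open>Temporal difference steps for an abstract contraction\<close>

locale td_process =
  fixes X :: "'z set" and K :: "'z \<Rightarrow> 'z \<Rightarrow> real" and \<nu> :: "'z \<Rightarrow> real" and L :: real
    and G :: "('z \<Rightarrow> real) \<Rightarrow> 'z \<Rightarrow> real" and Q :: "'z \<Rightarrow> real" and \<gamma> R \<kappa> :: real
  assumes X: "finite X" "X \<noteq> {}"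
    and K: "\<And>z. z \<in> X \<Longrightarrow> K z \<in> prob_simplex X"
    and \<nu>: "\<nu> \<in> prob_simplex X"
    and L: "\<And>n z. z \<in> X \<Longrightarrow> (\<Sum>i<n. \<Sum>y\<in>X. \<bar>kernel_pow X K i z y - \<nu> y\<bar>) \<le> L"
    and \<gamma>: "0 \<le> \<gamma>" "\<gamma> \<le> 1" and \<kappa>: "0 \<le> \<kappa>" "\<kappa> \<le> 1"
    and lipschitz: "\<And>x y m z. \<lbrakk>\<And>z. z \<in> X \<Longrightarrow> \<bar>x z - y z\<bar> \<le> m; z \<in> X\<rbrakk> \<Longrightarrow> \<bar>G x z - G y z\<bar> \<le> \<gamma> * m"
    and fixed_point: "\<And>z. z \<in> X \<Longrightarrow> G Q z = Q z"
    and Q: "\<And>z. z \<in> X \<Longrightarrow> 0 \<le> Q z \<and> Q z \<le> R"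
begin

definition avg :: "('z \<Rightarrow> real) \<Rightarrow> 'z \<Rightarrow> real" where
  "avg x z = (\<Sum>w\<in>X. K z w * x w)"

definition td_upd :: "real \<Rightarrow> ('z \<Rightarrow> real) \<Rightarrow> 'z \<Rightarrow> 'z \<Rightarrow> 'z \<Rightarrow> real" where
  "td_upd \<alpha> \<theta> z z' = (\<lambda>y. \<theta> y + \<alpha> * ((G \<theta> z - \<theta> z + \<kappa> * (\<theta> z' - avg \<theta> z)) * basis_vec z y))"

text \<open>
  Alongside \<open>\<theta>\<close> we follow the part \<open>W\<close> of the error that is driven by the martingale differences
  alone, the numbers \<open>N\<close> of visits and the accumulated squares \<open>Y\<close> of \<open>W\<close>.
\<close>

definition noise_upd :: "real \<Rightarrow> ('z \<Rightarrow> real) \<Rightarrow> ('z \<Rightarrow> real) \<Rightarrow> 'z \<Rightarrow> 'z \<Rightarrow> 'z \<Rightarrow> real" where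
  "noise_upd \<alpha> \<theta> W z z' = (\<lambda>y. if y = z then (1 - \<alpha>) * W z + \<alpha> * (\<kappa> * (\<theta> z' - avg \<theta> z)) else W y)"

definition ext_upd ::
  "real \<Rightarrow> ('z \<Rightarrow> real) \<times> ('z \<Rightarrow> real) \<times> ('z \<Rightarrow> nat) \<times> real \<Rightarrow> 'z \<Rightarrow> 'z
    \<Rightarrow> ('z \<Rightarrow> real) \<times> ('z \<Rightarrow> real) \<times> ('z \<Rightarrow> nat) \<times> real" where
  "ext_upd \<alpha> = (\<lambda>(\<theta>, W, N, Y) z z'. (td_upd \<alpha> \<theta> z z', noise_upd \<alpha> \<theta> W z z',
     (\<lambda>y. if y = z then Suc (N y) else N y), Y + (\<Sum>y\<in>X. (W y)\<^sup>2)))"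

text \<open>Expected visits to \<open>y\<close> at the next \<open>n\<close> times from
  \<open>z\<close>, the present included, minus the stationary mean: a truncated solution of the
  Poisson equation.\<close>

definition bias :: "nat \<Rightarrow> 'z \<Rightarrow> 'z \<Rightarrow> real" where
  "bias n z y = (\<Sum>i<n. kernel_pow X K i z y - \<nu> y)"

text \<open>
  With \<open>q\<close> the deviations of the visit counts from their means, the middle term is the expected
  cross term between present and future deviations, and \<open>2 L\<close> bounds the variance gained per step;
  this makes the potential a supermartingale.
\<close>

definition count_potential :: "nat \<Rightarrow> ('z \<Rightarrow> real) \<Rightarrow> 'z \<Rightarrow> real" where
  "count_potential n q z = (\<Sum>y\<in>X. (q y)\<^sup>2) + 2 * (\<Sum>y\<in>X. q y * bias n z y) + 2 * real n * L"

lemma avg_const: "z \<in> X \<Longrightarrow> avg (\<lambda>_. b) z = b"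
  using prob_simplexD(2)[OF K] by (simp add: avg_def flip: sum_distrib_right)

lemma avg_add: "avg (\<lambda>w. x w + y w) z = avg x z + avg y z"
  by (simp add: avg_def distrib_left sum.distrib)

lemma avg_diff: "avg (\<lambda>w. x w - y w) z = avg x z - avg y z"
  by (simp add: avg_def right_diff_distrib sum_subtractf)

lemma avg_mult: "avg (\<lambda>w. b * x w) z = b * avg x z"
  by (simp add: avg_def sum_distrib_left mult.left_commute)

lemma avg_sum: "avg (\<lambda>w. \<Sum>y\<in>Y. x y w) z = (\<Sum>y\<in>Y. avg (x y) z)"
  unfolding avg_def by (subst sum.swap) (simp add: sum_distrib_left)

lemma avg_mono: "z \<in> X \<Longrightarrow> (\<And>w. w \<in> X \<Longrightarrow> x w \<le> y w) \<Longrightarrow> avg x z \<le> avg y z"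
  unfolding avg_def using prob_simplexD(1)[OF K] by (intro sum_mono mult_left_mono) auto

lemma avg_le: "z \<in> X \<Longrightarrow> (\<And>w. w \<in> X \<Longrightarrow> x w \<le> b) \<Longrightarrow> avg x z \<le> b"
  using avg_mono[of z x "\<lambda>_. b"] by (simp add: avg_const)

lemma le_avg: "z \<in> X \<Longrightarrow> (\<And>w. w \<in> X \<Longrightarrow> b \<le> x w) \<Longrightarrow> b \<le> avg x z"
  using avg_mono[of z "\<lambda>_. b" x] by (simp add: avg_const)

text \<open>The Poisson equation: averaging over one transition shifts the time window and so
  removes the term of the present.\<close>

lemma avg_bias:
  assumes "z \<in> X"
  shows "avg (\<lambda>w. bias n w y) z = bias (Suc n) z y - (kernel_pow X K 0 z y - \<nu> y)"
proof -
  have "avg (\<lambda>w. bias n w y) z = (\<Sum>i<n. avg (\<lambda>w. kernel_pow X K i w y) z - \<nu> y)"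
    using assms by (simp add: bias_def avg_sum avg_diff avg_const)
  then show ?thesis
    unfolding bias_def sum.lessThan_Suc_shift by (simp add: avg_def)
qed

lemma sum_abs_bias_le: "z \<in> X \<Longrightarrow> (\<Sum>y\<in>X. \<bar>bias n z y\<bar>) \<le> L"
proof -
  assume z: "z \<in> X"
  have "(\<Sum>y\<in>X. \<bar>bias n z y\<bar>) \<le> (\<Sum>y\<in>X. \<Sum>i<n. \<bar>kernel_pow X K i z y - \<nu> y\<bar>)"
    unfolding bias_def by (intro sum_mono sum_abs)
  also have "\<dots> \<le> L"
    using L[OF z, of n] by (subst sum.swap)
  finally show ?thesis .
qed

lemma \<nu>_le_1: "y \<in> X \<Longrightarrow> \<nu> y \<le> 1"
  using X prob_simplexD[OF \<nu>] member_le_sum[of y X \<nu>] by auto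

text \<open>The Poisson equation cancels the cross term between \<open>q\<close> and its increment
  \<open>h\<close>. Only \<open>2 h b - h\<^sup>2\<close> is left, and summing
  \<open>2 \<bar>b\<bar>\<close> costs at most \<open>2 L\<close>.\<close>

lemma count_potential_drift:
  assumes z: "z \<in> X"
  shows "avg (\<lambda>w. count_potential n (\<lambda>y. q y + ((if y = z then 1 else 0) - \<nu> y)) w) z
    \<le> count_potential (Suc n) q z"
proof -
  define h where "h y = (if y = z then 1 else 0) - \<nu> y" for y
  define b where "b y = bias (Suc n) z y" for y
  have h1: "\<bar>h y\<bar> \<le> 1" if "y \<in> X" for y
    using \<nu>_le_1[OF that] prob_simplexD(1)[OF \<nu>, of y] by (auto simp: h_def)
  have "avg (\<lambda>w. count_potential n (\<lambda>y. q y + h y) w) z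
      = (\<Sum>y\<in>X. (q y + h y)\<^sup>2) + 2 * (\<Sum>y\<in>X. (q y + h y) * avg (\<lambda>w. bias n w y) z) + 2 * real n * L"
    using z by (simp add: count_potential_def avg_add avg_mult avg_sum avg_const)
  also have "\<dots> = (\<Sum>y\<in>X. (q y + h y)\<^sup>2 + 2 * ((q y + h y) * (b y - h y))) + 2 * real n * L"
    using z by (simp add: avg_bias b_def h_def sum.distrib sum_distrib_left eq_commute[of z])
  also have "(\<Sum>y\<in>X. (q y + h y)\<^sup>2 + 2 * ((q y + h y) * (b y - h y)))
      = (\<Sum>y\<in>X. (q y)\<^sup>2 + 2 * (q y * b y) + 2 * (h y * b y) - (h y)\<^sup>2)"
    by (intro sum.cong refl) (simp add: power2_eq_square algebra_simps)
  also have "\<dots> \<le> (\<Sum>y\<in>X. (q y)\<^sup>2 + 2 * (q y * b y) + 2 * \<bar>b y\<bar>)"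
  proof (intro sum_mono)
    fix y assume "y \<in> X"
    have "h y * b y \<le> \<bar>h y\<bar> * \<bar>b y\<bar>"
      by (metis abs_ge_self abs_mult)
    also have "\<dots> \<le> 1 * \<bar>b y\<bar>"
      using h1[OF \<open>y \<in> X\<close>] by (intro mult_right_mono) auto
    finally show "(q y)\<^sup>2 + 2 * (q y * b y) + 2 * (h y * b y) - (h y)\<^sup>2
        \<le> (q y)\<^sup>2 + 2 * (q y * b y) + 2 * \<bar>b y\<bar>"
      using zero_le_power2[of "h y"] by linarith
  qed
  also have "\<dots> = (\<Sum>y\<in>X. (q y)\<^sup>2) + 2 * (\<Sum>y\<in>X. q y * b y) + 2 * (\<Sum>y\<in>X. \<bar>b y\<bar>)"
    by (simp add: sum.distrib sum_distrib_left)
  also have "\<dots> \<le> (\<Sum>y\<in>X. (q y)\<^sup>2) + 2 * (\<Sum>y\<in>X. q y * b y) + 2 * L"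
    using sum_abs_bias_le[OF z, of "Suc n"] by (simp add: b_def)
  finally show ?thesis
    by (simp add: count_potential_def b_def h_def algebra_simps)
qed

text \<open>Only coordinate \<open>z\<close> changes, and the term linear in the martingale
  difference averages to 0; the old square is merely damped.\<close>

lemma noise_square_drift:
  assumes z: "z \<in> X" and \<alpha>: "0 \<le> \<alpha>" "\<alpha> \<le> 1" and d: "\<And>w. w \<in> X \<Longrightarrow> \<bar>\<theta> w - avg \<theta> z\<bar> \<le> D"
  shows "avg (\<lambda>w. \<Sum>y\<in>X. (noise_upd \<alpha> \<theta> W z w y)\<^sup>2) z \<le> (\<Sum>y\<in>X. (W y)\<^sup>2) + \<alpha>\<^sup>2 * D\<^sup>2"
proof -
  define d where "d w = \<kappa> * (\<theta> w - avg \<theta> z)" for w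
  have d0: "avg d z = 0"
    using z by (simp add: d_def[abs_def] avg_mult avg_diff avg_const)
  have dD: "(d w)\<^sup>2 \<le> D\<^sup>2" if "w \<in> X" for w
  proof -
    have "\<bar>d w\<bar> \<le> 1 * D"
      unfolding d_def abs_mult using \<kappa> d[OF that] by (intro mult_mono) auto
    then show ?thesis
      by (metis abs_ge_zero mult_1 power2_abs power_mono)
  qed
  have "(\<Sum>y\<in>X. (noise_upd \<alpha> \<theta> W z w y)\<^sup>2)
      = ((1 - \<alpha>) * W z + \<alpha> * d w)\<^sup>2 + (\<Sum>y\<in>X - {z}. (W y)\<^sup>2)" for w
    using X z by (subst sum.remove[of _ z]) (auto simp: noise_upd_def d_def intro!: sum.cong)
  also have "\<dots> w = ((1 - \<alpha>)\<^sup>2 * (W z)\<^sup>2 + (\<Sum>y\<in>X - {z}. (W y)\<^sup>2))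
      + (2 * (1 - \<alpha>) * W z * \<alpha>) * d w + \<alpha>\<^sup>2 * (d w)\<^sup>2" for w
    by (simp add: power2_eq_square algebra_simps)
  finally have "avg (\<lambda>w. \<Sum>y\<in>X. (noise_upd \<alpha> \<theta> W z w y)\<^sup>2) z
      = ((1 - \<alpha>)\<^sup>2 * (W z)\<^sup>2 + (\<Sum>y\<in>X - {z}. (W y)\<^sup>2)) + \<alpha>\<^sup>2 * avg (\<lambda>w. (d w)\<^sup>2) z"
    using z d0 by (simp only: avg_add avg_mult avg_const)
  also have "\<dots> \<le> (1 * (W z)\<^sup>2 + (\<Sum>y\<in>X - {z}. (W y)\<^sup>2)) + \<alpha>\<^sup>2 * D\<^sup>2"
    using \<alpha> dD z by (intro add_mono mult_right_mono mult_left_mono avg_le) (auto intro: power_le_one)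
  also have "1 * (W z)\<^sup>2 + (\<Sum>y\<in>X - {z}. (W y)\<^sup>2) = (\<Sum>y\<in>X. (W y)\<^sup>2)"
    using X z by (simp add: sum.remove[of X z])
  finally show ?thesis .
qed

end

text \<open>By Bernoulli, \<open>(1 - a) ^ n * (1 + n a) \<le> (1 - a\<^sup>2) ^ n \<le> 1\<close>.
  This turns the number of visits into a linear gain.\<close>

lemma one_minus_power_le:
  fixes a :: real
  assumes "0 \<le> a" "a \<le> 1" "n * a \<le> 1"
  shows "(1 - a) ^ n \<le> 1 - n * a / 2"
proof -
  have "(1 - a) ^ n * (1 + n * a) \<le> (1 - a) ^ n * (1 + a) ^ n"
    using assms by (intro mult_left_mono Bernoulli_inequality) auto
  also have "\<dots> = (1 - a\<^sup>2) ^ n"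
    by (simp add: power_mult_distrib[symmetric] power2_eq_square algebra_simps)
  also have "\<dots> \<le> 1"
    using assms by (intro power_le_one) (auto simp: power2_eq_square mult_le_one)
  finally have "(1 - a) ^ n \<le> 1 / (1 + n * a)"
    using assms by (subst pos_le_divide_eq) (auto intro: add_pos_nonneg)
  also have "1 \<le> (1 - n * a / 2) * (1 + n * a)"
    using assms mult_left_mono[of "n * a" 1 "n * a"] by (simp add: algebra_simps)
  then have "1 / (1 + n * a) \<le> 1 - n * a / 2"
    using assms by (subst pos_divide_le_eq) (auto intro: add_pos_nonneg)
  finally show ?thesis .
qed

section \<open>Pathwise invariants along a block\<close>

context td_process
begin

lemma td_upd_other: "y \<noteq> z \<Longrightarrow> td_upd \<alpha> \<theta> z z' y = \<theta> y"
  by (simp add: td_upd_def basis_vec_def)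

lemma td_upd_error:
  "td_upd \<alpha> \<theta> z z' z - Q z
    = (1 - \<alpha>) * (\<theta> z - Q z) + \<alpha> * (G \<theta> z - Q z) + \<alpha> * (\<kappa> * (\<theta> z' - avg \<theta> z))"
  by (simp add: td_upd_def basis_vec_def algebra_simps)

lemma G_error:
  assumes "\<And>y. y \<in> X \<Longrightarrow> \<bar>\<theta> y - Q y\<bar> \<le> m" "z \<in> X"
  shows "\<bar>G \<theta> z - Q z\<bar> \<le> \<gamma> * m"
  using lipschitz[of \<theta> Q m z] fixed_point[OF assms(2)] assms by simp

lemma martingale_difference_le:
  assumes m: "\<And>y. y \<in> X \<Longrightarrow> \<bar>\<theta> y - Q y\<bar> \<le> m" and z: "z \<in> X" and z': "z' \<in> X"
  shows "\<bar>\<theta> z' - avg \<theta> z\<bar> \<le> 2 * m + R"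
proof -
  let ?E = "\<lambda>y. \<theta> y - Q y"
  have "avg \<theta> z = avg ?E z + avg Q z"
    by (simp flip: avg_add)
  moreover have "avg ?E z \<le> m" "- m \<le> avg ?E z"
    using m by (intro avg_le le_avg z; force)+
  moreover have "avg Q z \<le> R" "0 \<le> avg Q z"
    using Q by (intro avg_le le_avg z; simp)+
  ultimately show ?thesis
    using m[OF z'] Q[OF z'] by linarith
qed

text \<open>
  The invariant along a block that starts with sup-norm error \<open>E\<close>.  The error without the noise,
  \<open>\<theta> - Q - W\<close>, contracts towards \<open>\<gamma> E\<close> at each visit, up to the accumulated noise; \<open>s\<close> is the scale
  of the AM-GM bound \<open>\<bar>W y\<bar> \<le> (\<bar>W\<bar>\<^sup>2 / s + s) / 2\<close>, by which expectations of squares suffice.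
\<close>

definition block_inv ::
  "real \<Rightarrow> real \<Rightarrow> real \<Rightarrow> nat \<Rightarrow> ('z \<Rightarrow> real) \<times> ('z \<Rightarrow> real) \<times> ('z \<Rightarrow> nat) \<times> real \<Rightarrow> bool" where
  "block_inv \<alpha> s E j = (\<lambda>(\<theta>, W, N, Y). 0 \<le> Y \<and> (\<forall>y\<in>X. N y \<le> j \<and>
     \<bar>\<theta> y - Q y\<bar> + R \<le> (1 + 2 * \<alpha>) ^ j * (E + R) \<and>
     \<bar>\<theta> y - Q y - W y\<bar> \<le> E * (\<gamma> + (1 - \<gamma>) * (1 - \<alpha>) ^ N y) + \<alpha> * ((Y / s + j * s) / 2)))"

text \<open>The crude bound \<open>grow\<close> gains a factor \<open>1 + 2 \<alpha>\<close> per
  step. In \<open>contract\<close> the martingale difference cancels between \<theta> and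
  \<open>W\<close>, leaving a convex combination of the old residual and the error of
  \<open>G\<close>.\<close>

lemma block_inv_step:
  assumes inv: "block_inv \<alpha> s E j x" and \<alpha>: "0 \<le> \<alpha>" "\<alpha> \<le> 1" and s: "0 < s" and E: "0 \<le> E"
    and z: "z \<in> X" and z': "z' \<in> X"
  shows "block_inv \<alpha> s E (Suc j) (ext_upd \<alpha> x z z')"
proof -
  obtain \<theta> W N Y where x: "x = (\<theta>, W, N, Y)" by (cases x)
  define w where "w = (\<Sum>y\<in>X. (W y)\<^sup>2)"
  define nw where "nw = (w / s + s) / 2"
  define Sj where "Sj = (Y / s + j * s) / 2"
  define M where "M = (1 + 2 * \<alpha>) ^ j * (E + R) - R"
  have Y: "0 \<le> Y" and N: "\<And>y. y \<in> X \<Longrightarrow> N y \<le> j"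
    and eM: "\<And>y. y \<in> X \<Longrightarrow> \<bar>\<theta> y - Q y\<bar> \<le> M"
    and V: "\<And>y. y \<in> X \<Longrightarrow> \<bar>\<theta> y - Q y - W y\<bar> \<le> E * (\<gamma> + (1 - \<gamma>) * (1 - \<alpha>) ^ N y) + \<alpha> * Sj"
    using inv by (auto simp: block_inv_def x M_def Sj_def algebra_simps)
  have w0: "0 \<le> w" unfolding w_def by (intro sum_nonneg) auto
  have nw0: "0 \<le> nw" using w0 s by (simp add: nw_def)
  have S0: "0 \<le> Sj" using Y s by (simp add: Sj_def)
  have S': "((Y + w) / s + Suc j * s) / 2 = Sj + nw"
    by (simp add: Sj_def nw_def add_divide_distrib algebra_simps)
  have R0: "0 \<le> R" using Q z by force
  have M0: "0 \<le> M" using eM[OF z] by linarith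
  have N': "(if y = z then Suc (N y) else N y) \<le> Suc j" if "y \<in> X" for y
    using N[OF that] by auto
  have MR: "(1 + 2 * \<alpha>) ^ Suc j * (E + R) = (1 + 2 * \<alpha>) * (M + R)"
    by (simp add: M_def)
  have grow: "\<bar>td_upd \<alpha> \<theta> z z' y - Q y\<bar> + R \<le> (1 + 2 * \<alpha>) ^ Suc j * (E + R)" if y: "y \<in> X" for y
  proof (cases "y = z")
    case True
    have "\<bar>td_upd \<alpha> \<theta> z z' z - Q z\<bar>
        \<le> (1 - \<alpha>) * \<bar>\<theta> z - Q z\<bar> + \<alpha> * \<bar>G \<theta> z - Q z\<bar> + \<alpha> * (\<kappa> * \<bar>\<theta> z' - avg \<theta> z\<bar>)"
      unfolding td_upd_error using \<alpha> \<kappa>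
      by (intro order_trans[OF abs_triangle_ineq] add_mono) (auto simp: abs_mult)
    also have "\<dots> \<le> (1 - \<alpha>) * M + \<alpha> * (1 * M) + \<alpha> * (1 * (2 * M + R))"
      using \<alpha> \<gamma> \<kappa> eM[OF z] M0 R0 G_error[OF eM z] martingale_difference_le[OF eM z z']
      by (intro add_mono mult_left_mono mult_mono order_trans[OF G_error[OF eM z]]) auto
    also have "\<dots> + R \<le> (1 + 2 * \<alpha>) * (M + R)"
      using \<alpha> R0 by (simp add: algebra_simps)
    finally show ?thesis unfolding MR using True by simp
  next
    case False
    have "M + R \<le> (1 + 2 * \<alpha>) * (M + R)"
      using \<alpha> M0 R0 by (simp add: algebra_simps)
    then show ?thesis unfolding MR td_upd_other[OF False] using eM[OF y] by linarith
  qed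
  have contract: "\<bar>td_upd \<alpha> \<theta> z z' y - Q y - noise_upd \<alpha> \<theta> W z z' y\<bar>
      \<le> E * (\<gamma> + (1 - \<gamma>) * (1 - \<alpha>) ^ (if y = z then Suc (N y) else N y))
        + \<alpha> * (Sj + nw)" if y: "y \<in> X" for y
  proof (cases "y = z")
    case True
    define p where "p = (1 - \<alpha>) ^ N z"
    \<comment> \<open>Bound on the full error: the contracted part is at most \<open>E\<close>, to
      which the accumulated and the present noise are added.\<close>
    define m where "m = E + \<alpha> * Sj + nw"
    have p: "0 \<le> p" "p \<le> 1" using \<alpha> by (auto simp: p_def power_le_one)
    have "\<bar>\<theta> y - Q y\<bar> \<le> m" if "y \<in> X" for y
    proof -
      have "(1 - \<gamma>) * (1 - \<alpha>) ^ N y \<le> (1 - \<gamma>) * 1"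
        using \<alpha> \<gamma> by (intro mult_left_mono power_le_one) auto
      then have "E * (\<gamma> + (1 - \<gamma>) * (1 - \<alpha>) ^ N y) \<le> E * 1"
        using E by (intro mult_left_mono) auto
      then show ?thesis
        using V[OF that] abs_le_square_mean[OF X(1) that s, of W] unfolding m_def nw_def w_def by linarith
    qed
    note Gm = G_error[OF this z]
    have "\<bar>td_upd \<alpha> \<theta> z z' z - Q z - noise_upd \<alpha> \<theta> W z z' z\<bar>
        = \<bar>(1 - \<alpha>) * (\<theta> z - Q z - W z) + \<alpha> * (G \<theta> z - Q z)\<bar>"
      unfolding td_upd_error by (simp add: noise_upd_def algebra_simps)
    also have "\<dots> \<le> (1 - \<alpha>) * \<bar>\<theta> z - Q z - W z\<bar> + \<alpha> * \<bar>G \<theta> z - Q z\<bar>"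
      using \<alpha> by (intro order_trans[OF abs_triangle_ineq]) (simp add: abs_mult)
    also have "\<dots> \<le> (1 - \<alpha>) * (E * (\<gamma> + (1 - \<gamma>) * p) + \<alpha> * Sj) + \<alpha> * (\<gamma> * m)"
      using \<alpha> V[OF z] Gm by (intro add_mono mult_left_mono) (auto simp: p_def)
    also have "\<dots> = E * (\<gamma> + (1 - \<gamma>) * ((1 - \<alpha>) * p)) + \<alpha> * (Sj + nw)
        - \<alpha> * (1 - \<gamma>) * (\<alpha> * Sj + nw)"
      unfolding m_def by (simp add: algebra_simps)
    also have "\<dots> \<le> E * (\<gamma> + (1 - \<gamma>) * ((1 - \<alpha>) * p)) + \<alpha> * (Sj + nw)"
      using \<alpha> \<gamma> S0 nw0 by simp
    finally show ?thesis using True by (simp add: p_def)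
  next
    case False
    have "\<alpha> * Sj \<le> \<alpha> * (Sj + nw)"
      using \<alpha> nw0 by (intro mult_left_mono) auto
    then show ?thesis
      using V[OF y] False by (simp add: td_upd_other noise_upd_def)
  qed
  show ?thesis
    using Y w0 N' grow contract
    unfolding x ext_upd_def block_inv_def prod.case w_def[symmetric] S' by auto
qed

lemma block_inv_start:
  assumes "\<And>y. y \<in> X \<Longrightarrow> \<bar>\<theta> y - Q y\<bar> \<le> E"
  shows "block_inv \<alpha> s E 0 (\<theta>, \<lambda>_. 0, \<lambda>_. 0, 0)"
  using assms by (auto simp: block_inv_def)

text \<open>While \<open>j \<alpha> \<le> 1 / 8\<close> the growth factor is at most
  \<open>exp (1 / 4) \<le> 2\<close>, so martingale differences have a deterministic bound
  throughout the block.\<close>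

lemma block_inv_growth:
  assumes inv: "block_inv \<alpha> s E j (\<theta>, W, N, Y)" and \<alpha>: "0 \<le> \<alpha>" "8 * (j * \<alpha>) \<le> 1" and E: "0 \<le> E" and R: "0 \<le> R"
    and z: "z \<in> X" and z': "z' \<in> X"
  shows "\<bar>\<theta> z' - avg \<theta> z\<bar> \<le> 4 * (E + R)"
proof -
  have "(1 + 2 * \<alpha>) ^ j \<le> exp (2 * \<alpha>) ^ j"
    using \<alpha> by (intro power_mono exp_ge_add_one_self) auto
  also have "\<dots> = exp (2 * (j * \<alpha>))"
    by (simp add: exp_of_nat_mult[symmetric] mult.left_commute)
  also have "\<dots> \<le> 2"
    using exp_bound_half[of "2 * (j * \<alpha>)"] \<alpha> by simp
  finally have "(1 + 2 * \<alpha>) ^ j * (E + R) \<le> 2 * (E + R)"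
    using E R by (intro mult_right_mono) auto
  then have "\<bar>\<theta> y - Q y\<bar> \<le> 2 * (E + R) - R" if "y \<in> X" for y
    using inv that by (force simp: block_inv_def)
  from martingale_difference_le[OF this z z'] R show ?thesis by simp
qed

end

lemma sup_norm_le_iff:
  assumes "finite X" "X \<noteq> {}"
  shows "sup_norm X x \<le> b \<longleftrightarrow> (\<forall>z\<in>X. \<bar>x z\<bar> \<le> b)"
  using assms by (simp add: sup_norm_def)

lemma le_sup_norm: "finite X \<Longrightarrow> z \<in> X \<Longrightarrow> \<bar>x z\<bar> \<le> sup_norm X x"
  by (simp add: sup_norm_def)

lemma step_op_funpow_affine_le:
  assumes K: "\<And>z. z \<in> X \<Longrightarrow> K z \<in> prob_simplex X"
    and le: "\<And>x z. z \<in> X \<Longrightarrow> g x z \<le> a * g' x z + b" and z: "z \<in> X"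
  shows "(step_op X K upd ^^ n) g x z \<le> a * (step_op X K upd ^^ n) g' x z + b"
  using z
proof (induction n arbitrary: x z)
  case (Suc n)
  let ?f = "(step_op X K upd ^^ n) g'"
  have "(step_op X K upd ^^ Suc n) g x z \<le> (\<Sum>z'\<in>X. K z z' * (a * ?f (upd x z z') z' + b))"
    unfolding funpow.simps comp_def step_op_def[of X K upd _ x z]
    using Suc prob_simplexD(1)[OF K] by (intro sum_mono mult_left_mono) auto
  also have "\<dots> = a * (\<Sum>z'\<in>X. K z z' * ?f (upd x z z') z') + (\<Sum>z'\<in>X. K z z') * b"
    by (simp add: distrib_left sum.distrib sum_distrib_left sum_distrib_right mult.left_commute)
  finally show ?case
    using prob_simplexD(2)[OF K[OF Suc.prems]] by (simp add: step_op_def[of X K upd _ x z])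
qed (use le in simp)

context td_process
begin

text \<open>
  Upper bound for the expected error at the end of a block of length \<open>B\<close>, given its first \<open>j\<close>
  steps, where \<open>e\<close> bounds the one-step growth of the second moment of \<open>W\<close>.  The terms control the
  visit counts, the accumulated noise and the final noise.
\<close>

definition block_potential ::
  "nat \<Rightarrow> real \<Rightarrow> real \<Rightarrow> real \<Rightarrow> real \<Rightarrow> real \<Rightarrow> nat
    \<Rightarrow> ('z \<Rightarrow> real) \<times> ('z \<Rightarrow> real) \<times> ('z \<Rightarrow> nat) \<times> real \<Rightarrow> 'z \<Rightarrow> real" where
  "block_potential B e c0 c1 c2 c3 j = (\<lambda>(\<theta>, W, N, Y) z.
     c0 + c1 * count_potential (B - j) (\<lambda>y. real (N y) - real j * \<nu> y) z
     + c2 * (Y + real (B - j) * (\<Sum>y\<in>X. (W y)\<^sup>2) + (real (B - j))\<^sup>2 * e)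
     + c3 * ((\<Sum>y\<in>X. (W y)\<^sup>2) + real (B - j) * e))"

text \<open>With \<open>n\<close> steps left after this one, \<open>Y\<close> still collects about
  \<open>n\<close> times the present square of \<open>W\<close>, plus growth \<open>e\<close> at
  each step; the quadratic term in \<open>e\<close> pays for this growth.\<close>

lemma block_potential_drift:
  assumes c: "0 \<le> c1" "0 \<le> c2" "0 \<le> c3" and j: "j < B" and z: "z \<in> X"
    and \<alpha>: "0 \<le> \<alpha>" "\<alpha> \<le> 1" and D: "\<And>w. w \<in> X \<Longrightarrow> \<bar>\<theta> w - avg \<theta> z\<bar> \<le> D"
  shows "step_op X K (ext_upd \<alpha>) (block_potential B (\<alpha>\<^sup>2 * D\<^sup>2) c0 c1 c2 c3 (Suc j)) (\<theta>, W, N, Y) z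
    \<le> block_potential B (\<alpha>\<^sup>2 * D\<^sup>2) c0 c1 c2 c3 j (\<theta>, W, N, Y) z"
proof -
  define n where "n = B - Suc j"
  have n: "B - j = Suc n" "B - Suc j = n" using j by (auto simp: n_def)
  define q where "q y = real (N y) - real j * \<nu> y" for y
  define e where "e = \<alpha>\<^sup>2 * D\<^sup>2"
  define w where "w = (\<Sum>y\<in>X. (W y)\<^sup>2)"
  define w' where "w' v = (\<Sum>y\<in>X. (noise_upd \<alpha> \<theta> W z v y)\<^sup>2)" for v
  define ps where "ps v = count_potential n (\<lambda>y. q y + ((if y = z then 1 else 0) - \<nu> y)) v" for v
  have q': "real (if y = z then Suc (N y) else N y) - real (Suc j) * \<nu> y
      = q y + ((if y = z then 1 else 0) - \<nu> y)" for y
    by (simp add: q_def algebra_simps)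
  have "step_op X K (ext_upd \<alpha>) (block_potential B e c0 c1 c2 c3 (Suc j)) (\<theta>, W, N, Y) z
      = avg (\<lambda>v. (c0 + c2 * (Y + w + (real n)\<^sup>2 * e) + c3 * (real n * e)) + c1 * ps v + (c2 * real n + c3) * w' v) z"
    unfolding step_op_def avg_def ext_upd_def block_potential_def prod.case q' n w_def[symmetric] w'_def[symmetric]
      ps_def[symmetric]
    by (intro sum.cong refl arg_cong2[where f = "(*)"]) (simp add: algebra_simps)
  also have "\<dots> = (c0 + c2 * (Y + w + (real n)\<^sup>2 * e) + c3 * (real n * e)) + c1 * avg ps z + (c2 * real n + c3) * avg w' z"
    by (simp only: avg_add avg_mult avg_const[OF z])
  also have "\<dots> \<le> (c0 + c2 * (Y + w + (real n)\<^sup>2 * e) + c3 * (real n * e))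
      + c1 * count_potential (Suc n) q z + (c2 * real n + c3) * (w + e)"
    unfolding w'_def[abs_def] ps_def[abs_def] e_def w_def using c
    by (intro add_mono mult_left_mono order_refl count_potential_drift noise_square_drift z \<alpha> D) auto
  also have "\<dots> = block_potential B e c0 c1 c2 c3 j (\<theta>, W, N, Y) z - c2 * real (Suc n) * e"
    unfolding block_potential_def prod.case n w_def[symmetric] q_def[abs_def]
    by (simp add: power2_eq_square algebra_simps)
  also have "\<dots> \<le> block_potential B e c0 c1 c2 c3 j (\<theta>, W, N, Y) z"
    using c by (simp add: e_def)
  finally show ?thesis unfolding e_def .
qed

text \<open>At the end of a block the terms for remaining steps vanish. AM-GM bounds the deviation
  of the visit count from below and \<open>W\<close> from above, so the invariant becomes linear in
  the tracked squares.\<close>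

lemma block_final_bound:
  assumes inv: "block_inv \<alpha> s E B (\<theta>, W, N, Y)" and \<alpha>: "0 < \<alpha>" "\<alpha> * B = 1 / 8"
    and s: "0 < s" "0 < s1" and E: "0 \<le> E" and \<nu>: "\<nu>min \<le> \<nu> y" and y: "y \<in> X"
  shows "\<bar>\<theta> y - Q y\<bar> \<le> block_potential B e
      (E * (1 - (1 - \<gamma>) * \<nu>min / 16 + \<alpha> * s1 / 4) + \<alpha> * B * s / 2 + s / 2)
      (E * \<alpha> / (4 * s1)) (\<alpha> / (2 * s)) (1 / (2 * s)) B (\<theta>, W, N, Y) z"
proof -
  define w where "w = (\<Sum>y\<in>X. (W y)\<^sup>2)"
  define q where "q y = real (N y) - real B * \<nu> y" for y
  define \<sigma> where "\<sigma> = (\<Sum>y\<in>X. (q y)\<^sup>2)"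
  define t where "t = (\<sigma> / s1 + s1) / 2"
  have NB: "N y \<le> B" and V: "\<bar>\<theta> y - Q y - W y\<bar> \<le> E * (\<gamma> + (1 - \<gamma>) * (1 - \<alpha>) ^ N y) + \<alpha> * ((Y / s + B * s) / 2)"
    using inv y by (auto simp: block_inv_def)
  have W: "\<bar>W y\<bar> \<le> (w / s + s) / 2"
    unfolding w_def by (rule abs_le_square_mean[OF X(1) y s(1)])
  have q: "\<bar>q y\<bar> \<le> t"
    unfolding t_def \<sigma>_def by (rule abs_le_square_mean[OF X(1) y s(2)])
  have N: "real B * \<nu>min - t \<le> N y"
    using q mult_left_mono[OF \<nu>, of "real B"] by (simp add: q_def)
  have t0: "0 \<le> t" using q by linarith
  have NA: "real (N y) * \<alpha> \<le> 1 / 8"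
  proof -
    have "real (N y) * \<alpha> \<le> real B * \<alpha>"
      using NB \<alpha> by (intro mult_right_mono) auto
    also have "\<dots> = 1 / 8"
      using \<alpha>(2) by (simp only: mult.commute)
    finally show ?thesis .
  qed
  have "1 \<le> real B" using \<alpha> by (cases B) auto
  then have "\<alpha> * 1 \<le> \<alpha> * B" using \<alpha>(1) by (intro mult_left_mono) auto
  then have \<alpha>1: "\<alpha> \<le> 1" using \<alpha> by simp
  have "(1 - \<alpha>) ^ N y \<le> 1 - N y * \<alpha> / 2"
    using \<alpha> \<alpha>1 NA by (intro one_minus_power_le) auto
  also have "\<dots> \<le> 1 - (real B * \<nu>min - t) * \<alpha> / 2"
    using mult_right_mono[OF N, of \<alpha>] \<alpha> by simp
  also have "\<dots> = 1 - (\<alpha> * B) * \<nu>min / 2 + \<alpha> * t / 2"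
    by (simp add: algebra_simps diff_divide_distrib)
  \<comment> \<open>\<open>\<alpha> B = 1 / 8\<close> turns the expected \<open>B \<nu>min\<close>
    visits into the gain \<open>\<nu>min / 16\<close>.\<close>
  also have "\<dots> = 1 - \<nu>min / 16 + \<alpha> * t / 2"
    unfolding \<alpha>(2) by simp
  finally have "\<gamma> + (1 - \<gamma>) * (1 - \<alpha>) ^ N y \<le> \<gamma> + (1 - \<gamma>) * (1 - \<nu>min / 16 + \<alpha> * t / 2)"
    using \<gamma> by (intro add_left_mono mult_left_mono) auto
  also have "\<dots> = 1 - (1 - \<gamma>) * \<nu>min / 16 + (1 - \<gamma>) * (\<alpha> * t / 2)"
    by (simp add: algebra_simps diff_divide_distrib)
  also have "\<dots> \<le> 1 - (1 - \<gamma>) * \<nu>min / 16 + 1 * (\<alpha> * t / 2)"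
    using \<gamma> \<alpha> t0 by (intro add_left_mono mult_right_mono) auto
  finally have "E * (\<gamma> + (1 - \<gamma>) * (1 - \<alpha>) ^ N y) \<le> E * (1 - (1 - \<gamma>) * \<nu>min / 16 + \<alpha> * t / 2)"
    using E by (intro mult_left_mono) auto
  with V W have "\<bar>\<theta> y - Q y\<bar> \<le> E * (1 - (1 - \<gamma>) * \<nu>min / 16 + \<alpha> * t / 2)
      + \<alpha> * ((Y / s + B * s) / 2) + (w / s + s) / 2"
    by linarith
  also have "\<dots> = block_potential B e
      (E * (1 - (1 - \<gamma>) * \<nu>min / 16 + \<alpha> * s1 / 4) + \<alpha> * B * s / 2 + s / 2)
      (E * \<alpha> / (4 * s1)) (\<alpha> / (2 * s)) (1 / (2 * s)) B (\<theta>, W, N, Y) z"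
    unfolding block_potential_def prod.case w_def[symmetric] q_def[symmetric]
    by (simp add: count_potential_def bias_def t_def \<sigma>_def[symmetric] add_divide_distrib distrib_left)
  finally show ?thesis .
qed

lemma block_expectation:
  assumes B: "0 < B" and \<alpha>: "\<alpha> = 1 / (8 * B)" and R: "0 < R" and L1: "1 \<le> L"
    and \<nu>: "\<And>y. y \<in> X \<Longrightarrow> \<nu>min \<le> \<nu> y" and z: "z \<in> X"
  shows "(step_op X K (td_upd \<alpha>) ^^ B) (\<lambda>\<theta> _. sup_norm X (\<lambda>y. \<theta> y - Q y)) \<theta> z
    \<le> (1 - (1 - \<gamma>) * \<nu>min / 16 + sqrt (L / B)) * sup_norm X (\<lambda>y. \<theta> y - Q y) + R * sqrt (L / B)"
proof -
  define E where "E = sup_norm X (\<lambda>y. \<theta> y - Q y)"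
  have err: "\<bar>\<theta> y - Q y\<bar> \<le> E" if "y \<in> X" for y
    unfolding E_def by (rule le_sup_norm[OF X(1) that])
  have E: "0 \<le> E" using err[OF z] by linarith
  define D where "D = 4 * (E + R)"
  \<comment> \<open>Both AM-GM scales balance their two terms: \<open>s\<^sup>2\<close> and
    \<open>s1\<^sup>2\<close> are the potential's initial bounds for the final squares of
    \<open>W\<close> and of the visit deviations.\<close>
  define s where "s = \<alpha> * sqrt B * D"
  define s1 where "s1 = sqrt (2 * B * L)"
  have \<alpha>': "0 < \<alpha>" "\<alpha> \<le> 1" "\<alpha> * B = 1 / 8" using B by (auto simp: \<alpha>)
  have D: "0 < D" using E R by (simp add: D_def)
  have s: "0 < s" using \<alpha>' D B by (simp add: s_def)
  have s1: "0 < s1" using B L1 by (simp add: s1_def)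
  define c0 where "c0 = E * (1 - (1 - \<gamma>) * \<nu>min / 16 + \<alpha> * s1 / 4) + \<alpha> * B * s / 2 + s / 2"
  let ?h = "block_potential B (\<alpha>\<^sup>2 * D\<^sup>2) c0 (E * \<alpha> / (4 * s1)) (\<alpha> / (2 * s)) (1 / (2 * s))"
  have "(step_op X K (td_upd \<alpha>) ^^ B) (\<lambda>\<theta> _. sup_norm X (\<lambda>y. \<theta> y - Q y)) \<theta> z
      = (step_op X K (ext_upd \<alpha>) ^^ B) (\<lambda>x _. sup_norm X (\<lambda>y. fst x y - Q y)) (\<theta>, \<lambda>_. 0, \<lambda>_. 0, 0) z"
    using step_op_funpow_project[where p = fst and upd = "ext_upd \<alpha>" and upd' = "td_upd \<alpha>"
        and g = "\<lambda>\<theta> _. sup_norm X (\<lambda>y. \<theta> y - Q y)" and x = "(\<theta>, \<lambda>_. 0, \<lambda>_. 0, 0)"]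
    by (simp add: ext_upd_def split_beta)
  also have "\<dots> \<le> ?h 0 (\<theta>, \<lambda>_. 0, \<lambda>_. 0, 0) z"
  proof (rule step_op_funpow_le[where I = "block_inv \<alpha> s E" and h = ?h])
    fix j x z z' assume "block_inv \<alpha> s E j x" "z \<in> X" "z' \<in> X"
    then show "block_inv \<alpha> s E (Suc j) (ext_upd \<alpha> x z z')"
      using \<alpha>' s E by (intro block_inv_step) auto
  next
    fix j x z assume j: "j < B" and inv: "block_inv \<alpha> s E j x" and z: "z \<in> X"
    obtain \<theta> W N Y where x: "x = (\<theta>, W, N, Y)" by (cases x)
    have "real j * \<alpha> \<le> real B * \<alpha>" using j \<alpha>' by (intro mult_right_mono) auto
    then have "\<bar>\<theta> w - avg \<theta> z\<bar> \<le> D" if "w \<in> X" for w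
      unfolding D_def using inv \<alpha>' E R z that unfolding x
      by (intro block_inv_growth) (auto simp: mult.commute)
    then show "step_op X K (ext_upd \<alpha>) (?h (Suc j)) x z \<le> ?h j x z"
      unfolding x using \<alpha>' E s s1 j z by (intro block_potential_drift) auto
  next
    fix x z assume inv: "block_inv \<alpha> s E B x"
    obtain \<theta> W N Y where x: "x = (\<theta>, W, N, Y)" by (cases x)
    show "sup_norm X (\<lambda>y. fst x y - Q y) \<le> ?h B x z"
      unfolding sup_norm_le_iff[OF X] x fst_conv c0_def
      using block_final_bound[OF inv[unfolded x] \<alpha>'(1,3) s s1 E \<nu>] by blast
  qed (use K z block_inv_start[OF err] in auto)
  also have "\<dots> = c0 + E * \<alpha> / (4 * s1) * (2 * B * L) + \<alpha> / (2 * s) * (B\<^sup>2 * (\<alpha>\<^sup>2 * D\<^sup>2))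
      + 1 / (2 * s) * (B * (\<alpha>\<^sup>2 * D\<^sup>2))"
    by (simp add: block_potential_def count_potential_def)
  also have "\<dots> = E * (1 - (1 - \<gamma>) * \<nu>min / 16 + \<alpha> * s1 / 2) + (\<alpha> * B) * s + s"
  proof -
    have ss: "s\<^sup>2 = B * (\<alpha>\<^sup>2 * D\<^sup>2)" "s1\<^sup>2 = 2 * B * L"
      using L1 by (simp_all add: s_def s1_def power_mult_distrib)
    have 1: "E * \<alpha> / (4 * s1) * (2 * B * L) = E * (\<alpha> * s1 / 4)"
      unfolding ss(2)[symmetric] using s1 by (simp add: power2_eq_square)
    have 2: "1 / (2 * s) * (B * (\<alpha>\<^sup>2 * D\<^sup>2)) = s / 2"
      unfolding ss(1)[symmetric] using s by (simp add: power2_eq_square)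
    have 3: "\<alpha> / (2 * s) * (B\<^sup>2 * (\<alpha>\<^sup>2 * D\<^sup>2)) = \<alpha> * B * (s / 2)"
      unfolding 2[symmetric] by (simp add: power2_eq_square)
    show ?thesis
      unfolding 1 2 3 c0_def by (simp add: algebra_simps)
  qed
  also have "\<dots> \<le> (1 - (1 - \<gamma>) * \<nu>min / 16 + sqrt (L / B)) * E + R * sqrt (L / B)"
  \<comment> \<open>The coefficients of \<open>sqrt (L / B)\<close> add up to
    \<open>1 / 8 + 9 / 16\<close> for \<open>E\<close> and \<open>9 / 16\<close> for
    \<open>R\<close>, both below 1.\<close>
  proof -
    have rB: "sqrt B * sqrt B = B" by simp
    have "\<alpha> * s1 / 2 = sqrt 2 / 16 * sqrt (L / B)"
      using B rB by (simp add: \<alpha> s1_def real_sqrt_mult real_sqrt_divide field_simps)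
    also have "\<dots> \<le> 1 / 8 * sqrt (L / B)"
      using sqrt2_less_2 L1 by (intro mult_right_mono) auto
    finally have 1: "\<alpha> * s1 / 2 \<le> 1 / 8 * sqrt (L / B)" .
    have "(\<alpha> * B) * s + s = 9 / 8 * s" unfolding \<alpha>'(3) by simp
    also have "\<dots> = 9 / 16 * (E + R) * (sqrt B / B)"
      using B by (simp add: s_def D_def \<alpha> field_simps)
    also have "\<dots> = 9 / 16 * (E + R) * (1 / sqrt B)"
      using B by (simp add: real_div_sqrt divide_eq_eq eq_divide_eq)
    also have "\<dots> \<le> 9 / 16 * (E + R) * sqrt (L / B)"
      using L1 E R by (intro mult_left_mono) (auto simp: real_sqrt_divide divide_right_mono)
    finally have 2: "(\<alpha> * B) * s + s \<le> 9 / 16 * (E + R) * sqrt (L / B)" .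
    have 3: "E * (\<alpha> * s1 / 2) \<le> E * (1 / 8 * sqrt (L / B))"
      using 1 E by (intro mult_left_mono)
    have 4: "0 \<le> E * sqrt (L / B)" "0 \<le> R * sqrt (L / B)"
      using E R L1 by auto
    show ?thesis
      using 2 3 4 by (simp add: algebra_simps)
  qed
  finally show ?thesis unfolding E_def .
qed

text \<open>A block gains \<open>2 \<delta>\<close> in the contraction factor and
  \<open>B_large\<close> gives back at most \<delta>. Restarting at each block end is composition of
  operator powers, and the additive errors form a geometric series bounded by
  \<open>\<eta> / \<delta>\<close>.\<close>

lemma blocks_expectation:
  assumes B: "0 < B" and \<alpha>: "\<alpha> = 1 / (8 * B)" and R: "0 < R" and L1: "1 \<le> L"
    and \<nu>: "\<And>y. y \<in> X \<Longrightarrow> \<nu>min \<le> \<nu> y" and z: "z \<in> X"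
    and \<delta>: "0 < \<delta>" "\<delta> \<le> 1" "\<delta> = (1 - \<gamma>) * \<nu>min / 32" and B_large: "sqrt (L / B) \<le> \<delta>"
  shows "(step_op X K (td_upd \<alpha>) ^^ (B * J)) (\<lambda>\<theta> _. sup_norm X (\<lambda>y. \<theta> y - Q y)) \<theta> z
    \<le> (1 - \<delta>) ^ J * sup_norm X (\<lambda>y. \<theta> y - Q y) + R * sqrt (L / B) / \<delta>"
proof -
  define \<eta> where "\<eta> = R * sqrt (L / B)"
  let ?g = "\<lambda>\<theta> (_ :: 'z). sup_norm X (\<lambda>y. \<theta> y - Q y)"
  have block: "(step_op X K (td_upd \<alpha>) ^^ B) ?g \<theta> z \<le> (1 - \<delta>) * ?g \<theta> z + \<eta>" if z: "z \<in> X" for \<theta> z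
  proof -
    have "0 \<le> ?g \<theta> z"
      using le_sup_norm[OF X(1) z, of "\<lambda>y. \<theta> y - Q y"] by linarith
    then have "(1 - (1 - \<gamma>) * \<nu>min / 16 + sqrt (L / B)) * ?g \<theta> z \<le> (1 - \<delta>) * ?g \<theta> z"
      using B_large \<delta> by (intro mult_right_mono) auto
    then show ?thesis
      using block_expectation[OF B \<alpha> R L1 \<nu> z, of \<theta>] unfolding \<eta>_def by linarith
  qed
  have "(step_op X K (td_upd \<alpha>) ^^ (B * J)) ?g \<theta> z \<le> (1 - \<delta>) ^ J * ?g \<theta> z + (1 - (1 - \<delta>) ^ J) * (\<eta> / \<delta>)"
    using z
  proof (induction J arbitrary: \<theta> z)
    case (Suc J)
    have "(step_op X K (td_upd \<alpha>) ^^ (B * Suc J)) ?g \<theta> z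
        = (step_op X K (td_upd \<alpha>) ^^ B) ((step_op X K (td_upd \<alpha>) ^^ (B * J)) ?g) \<theta> z"
      by (simp add: funpow_add)
    also have "\<dots> \<le> (1 - \<delta>) ^ J * (step_op X K (td_upd \<alpha>) ^^ B) ?g \<theta> z + (1 - (1 - \<delta>) ^ J) * (\<eta> / \<delta>)"
      using Suc.IH by (intro step_op_funpow_affine_le K Suc.prems)
    also have "\<dots> \<le> (1 - \<delta>) ^ J * ((1 - \<delta>) * ?g \<theta> z + \<eta>) + (1 - (1 - \<delta>) ^ J) * (\<eta> / \<delta>)"
      using block[OF Suc.prems] \<delta>(1,2) by (intro add_right_mono mult_left_mono) auto
    also have "\<dots> = (1 - \<delta>) ^ Suc J * ?g \<theta> z + (1 - (1 - \<delta>) ^ Suc J) * (\<eta> / \<delta>)"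
    proof -
      have "\<eta> = \<delta> * (\<eta> / \<delta>)" using \<delta>(1) by simp
      then show ?thesis
        using \<delta>(1) by (simp add: algebra_simps add_divide_distrib)
    qed
    finally show ?case .
  qed simp
  also have "\<dots> \<le> (1 - \<delta>) ^ J * ?g \<theta> z + 1 * (\<eta> / \<delta>)"
    using \<delta> R L1 by (intro add_left_mono mult_right_mono) (auto simp: \<eta>_def)
  finally show ?thesis by (simp add: \<eta>_def)
qed

end

section \<open>Choice of block length and number of blocks\<close>

text \<open>The lower bound makes rounding up the number of blocks cost at most a factor 2. In the
  upper bound \<open>\<epsilon> \<le> 1 / 2\<close> keeps \<open>ln (1 / \<epsilon>)\<close> above
  2/3, so its square absorbs constants.\<close>

lemma ln_initial_error_le:
  fixes \<epsilon> \<gamma> \<nu> r :: real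
  assumes \<epsilon>: "0 < \<epsilon>" "\<epsilon> \<le> 1 / 2" and \<gamma>: "0 < \<gamma>" "\<gamma> < 1" and \<nu>: "0 < \<nu>" "\<nu> \<le> 1" and r: "0 \<le> r"
  shows "1 \<le> ln (2 * (r + 1 / (1 - \<gamma>)) / \<epsilon>)"
    and "ln (2 * (r + 1 / (1 - \<gamma>)) / \<epsilon>) \<le> 8 * log_factor \<gamma> \<nu> r * (ln (1 / \<epsilon>))\<^sup>2"
proof -
  let ?R = "1 / (1 - \<gamma>)" and ?l = "ln (1 / \<epsilon>)" and ?F = "log_factor \<gamma> \<nu> r"
  have R: "1 \<le> ?R" using \<gamma> by simp
  have pos: "0 < r + ?R" using r R by linarith
  have l: "ln 2 \<le> ?l"
    using \<epsilon> by (subst ln_le_cancel_iff) (auto simp: field_simps)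
  have l2: "2 / 3 \<le> ?l" using ln2_ge_two_thirds l by linarith
  have eq: "ln (2 * (r + ?R) / \<epsilon>) = ln 2 + ln (r + ?R) + ?l"
    using pos \<epsilon> by (simp add: ln_mult ln_div del: distrib_left_numeral)
  have "0 \<le> ln (r + ?R)" using r R by (intro ln_ge_zero) linarith
  then show "1 \<le> ln (2 * (r + ?R) / \<epsilon>)"
    unfolding eq using ln2_ge_two_thirds l2 by linarith
  have "r + ?R \<le> (1 + r) * ?R"
    using mult_left_mono[OF R r] by (simp add: add_divide_distrib)
  then have "ln (r + ?R) \<le> ln ((1 + r) * ?R)"
    using pos r R by (subst ln_le_cancel_iff) auto
  also have "\<dots> = ln (1 + r) + ln ?R"
    using r \<gamma> by (intro ln_mult_pos) auto
  finally have "ln (r + ?R) \<le> ?F - 1"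
    using \<nu> unfolding log_factor_def by (smt (verit) ln_ge_zero le_divide_eq_1)
  moreover have F: "1 \<le> ?F"
    unfolding log_factor_def using r R \<nu> by (smt (verit) ln_ge_zero le_divide_eq_1)
  moreover have sq: "1 \<le> 4 * ?l\<^sup>2"
    using power_mono[OF l2, of 2] by (simp add: power2_eq_square)
  moreover have "?l \<le> 2 * ?l\<^sup>2"
    using mult_right_mono[of "1 / 2" ?l ?l] l2 by (simp add: power2_eq_square)
  moreover have "?F \<le> ?F * (4 * ?l\<^sup>2)" "4 * ?l\<^sup>2 \<le> ?F * (4 * ?l\<^sup>2)"
    using mult_left_mono[OF sq, of ?F] mult_right_mono[OF F, of "4 * ?l\<^sup>2"] F by simp_all
  ultimately show "ln (2 * (r + ?R) / \<epsilon>) \<le> 8 * ?F * ?l\<^sup>2"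
    unfolding eq using l by linarith
qed

lemma real_nat_ceiling_le:
  fixes x :: real
  assumes "1 \<le> x"
  shows "x \<le> real (nat \<lceil>x\<rceil>)" "real (nat \<lceil>x\<rceil>) \<le> 2 * x"
  using assms by linarith+

lemma block_parameters:
  fixes \<epsilon> \<gamma> \<nu> r L :: real
  assumes \<epsilon>: "0 < \<epsilon>" "\<epsilon> \<le> 1 / 2" and \<gamma>: "0 < \<gamma>" "\<gamma> < 1" and \<nu>: "0 < \<nu>" "\<nu> \<le> 1" and r: "0 \<le> r"
    and L: "1 \<le> L" and \<delta>: "\<delta> = (1 - \<gamma>) * \<nu> / 32"
  obtains B J :: nat where "0 < B" "sqrt (L / B) \<le> \<delta>" "1 / (1 - \<gamma>) * sqrt (L / B) / \<delta> \<le> \<epsilon> / 2"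
    "(1 - \<delta>) ^ J * (r + 1 / (1 - \<gamma>)) \<le> \<epsilon> / 2"
    "real (B * J) \<le> 4194304 * L * log_factor \<gamma> \<nu> r * rtd_rate \<epsilon> \<gamma> \<nu>"
proof -
  let ?R = "1 / (1 - \<gamma>)"
  \<comment> \<open>Target for \<open>sqrt (L / B)\<close>: it makes the limiting error
    \<open>?R * \<eta> / \<delta>\<close> equal to \<open>\<epsilon> / 2\<close> and is at most
    \<delta>.\<close>
  define \<eta> where "\<eta> = \<epsilon> * (1 - \<gamma>)\<^sup>2 * \<nu> / 64"
  define \<Lambda> where "\<Lambda> = ln (2 * (r + ?R) / \<epsilon>)"
  define B where "B = nat \<lceil>L / \<eta>\<^sup>2\<rceil>"
  \<comment> \<open>Enough blocks for \<open>exp (- J \<delta>)\<close> to bring the initial error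
    bound \<open>r + ?R\<close> down to \<open>\<epsilon> / 2\<close>.\<close>
  define J where "J = nat \<lceil>\<Lambda> / \<delta>\<rceil>"
  have \<delta>': "0 < \<delta>" "\<delta> \<le> 1"
    using \<gamma> \<nu> mult_le_one[of "1 - \<gamma>" \<nu>] by (auto simp: \<delta>)
  have \<eta>: "0 < \<eta>" "\<eta> = \<delta> * (\<epsilon> * (1 - \<gamma>) / 2)"
    using \<epsilon> \<gamma> \<nu> by (simp_all add: \<eta>_def \<delta> power2_eq_square)
  have "\<epsilon> * (1 - \<gamma>) / 2 \<le> 1"
    using \<epsilon> \<gamma> mult_le_one[of \<epsilon> "1 - \<gamma>"] by simp
  then have \<eta>\<delta>: "\<eta> \<le> \<delta>" unfolding \<eta>(2) using \<delta>' by simp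
  then have "\<eta>\<^sup>2 \<le> 1" using \<eta>(1) \<delta>' by (intro power_le_one) linarith+
  then have b: "1 \<le> L / \<eta>\<^sup>2" using L \<eta>(1) by (simp add: le_divide_eq)
  note Bx = real_nat_ceiling_le[OF b, folded B_def]
  have "1 \<le> \<Lambda>" unfolding \<Lambda>_def by (rule ln_initial_error_le[OF \<epsilon> \<gamma> \<nu> r])
  then have j: "1 \<le> \<Lambda> / \<delta>" using \<delta>' by (simp add: le_divide_eq)
  note Jx = real_nat_ceiling_le[OF j, folded J_def]
  have B: "0 < B" using Bx b by (cases B) auto
  have "L / B \<le> \<eta>\<^sup>2"
    using Bx(1) B \<eta>(1) by (simp add: divide_le_eq mult.commute)
  then have root: "sqrt (L / B) \<le> \<eta>"
    using \<eta>(1) by (intro real_le_lsqrt) auto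
  have pos: "0 < r + ?R" using r \<gamma> by (intro add_nonneg_pos) auto
  show thesis
  proof (rule that[OF B])
    show "sqrt (L / B) \<le> \<delta>" using root \<eta>\<delta> by linarith
    have "?R * sqrt (L / B) / \<delta> \<le> ?R * \<eta> / \<delta>"
      using root \<delta>' \<gamma> by (intro divide_right_mono mult_left_mono) auto
    also have "\<dots> = \<epsilon> / 2"
      unfolding \<eta>(2) using \<delta>' \<gamma> by simp
    finally show "?R * sqrt (L / B) / \<delta> \<le> \<epsilon> / 2" .
    have "(1 - \<delta>) ^ J \<le> exp (- \<delta>) ^ J"
      using \<delta>' exp_ge_add_one_self[of "- \<delta>"] by (intro power_mono) auto
    also have "\<dots> = exp (- (J * \<delta>))"
      by (simp add: exp_of_nat_mult[symmetric])
    also have "\<dots> \<le> exp (- \<Lambda>)"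
      using Jx(1) \<delta>' by (simp add: divide_le_eq)
    also have "\<dots> = \<epsilon> / (2 * (r + ?R))"
      unfolding \<Lambda>_def using pos \<epsilon> by (simp add: exp_minus)
    finally have "(1 - \<delta>) ^ J * (r + ?R) \<le> \<epsilon> / (2 * (r + ?R)) * (r + ?R)"
      using pos by (intro mult_right_mono) auto
    also have "\<dots> = \<epsilon> / 2" using pos by (simp del: distrib_left_numeral)
    finally show "(1 - \<delta>) ^ J * (r + ?R) \<le> \<epsilon> / 2" .
    have "real (B * J) \<le> (2 * (L / \<eta>\<^sup>2)) * (2 * (\<Lambda> / \<delta>))"
      unfolding of_nat_mult using Bx Jx b by (intro mult_mono) auto
    also have "\<dots> = 4 * L / (\<eta>\<^sup>2 * \<delta>) * \<Lambda>"
      by simp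
    also have "\<dots> \<le> 4 * L / (\<eta>\<^sup>2 * \<delta>) * (8 * log_factor \<gamma> \<nu> r * (ln (1 / \<epsilon>))\<^sup>2)"
      unfolding \<Lambda>_def using L \<delta>' ln_initial_error_le(2)[OF \<epsilon> \<gamma> \<nu> r] by (intro mult_left_mono) auto
    \<comment> \<open>\<open>131072 = 64\<^sup>2 * 32\<close>; multiplied by 4 from rounding and 8
      from the logarithm it gives 4194304.\<close>
    also have "\<eta>\<^sup>2 * \<delta> = ((1 - \<gamma>) ^ 5 * \<nu> ^ 3 * \<epsilon>\<^sup>2) / 131072"
      unfolding \<eta>_def \<delta> by (simp add: eval_nat_numeral field_simps)
    also have "4 * L / (((1 - \<gamma>) ^ 5 * \<nu> ^ 3 * \<epsilon>\<^sup>2) / 131072) * (8 * log_factor \<gamma> \<nu> r * (ln (1 / \<epsilon>))\<^sup>2)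
        = 4194304 * L * log_factor \<gamma> \<nu> r * rtd_rate \<epsilon> \<gamma> \<nu>"
      by (simp add: rtd_rate_def)
    finally show "real (B * J) \<le> 4194304 * L * log_factor \<gamma> \<nu> r * rtd_rate \<epsilon> \<gamma> \<nu>" .
  qed
qed

section \<open>The sample complexity bound\<close>

lemma (in robust_mdp) rtd_sample_complexity:
  assumes \<pi>: "\<pi> \<in> policies S A"
    and irr: "irreducible_chain S (state_kernel A \<pi> PN)" and aper: "aperiodic_chain S (state_kernel A \<pi> PN)"
    and stat: "stationary (S \<times> A) (state_action_kernel \<pi> PN) \<nu>"
    and \<nu>min: "\<nu>min = Min (\<nu> ` (S \<times> A))" "0 < \<nu>min"
    and f: "rtd_operator S A c \<gamma> PN U \<pi> f" and s0: "s0 \<in> S" and \<epsilon>: "0 < \<epsilon>" "\<epsilon> \<le> 1 / 2"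
  shows "\<exists>(\<alpha>::real) (T::nat). 0 < \<alpha> \<and>
    (LINT \<omega>|rtd_trajectory S A PN \<pi> s0. sup_norm (S \<times> A)
       (\<lambda>z. rtd f (\<lambda>t. \<alpha>) \<theta>0 \<omega> T z - Q_robust S A c \<gamma> PN U \<pi> z)) \<le> \<epsilon> \<and>
    real T \<le> 4194304 * (2 + 4 * real (mixing_time S (state_kernel A \<pi> PN) (\<lambda>s. \<Sum>a\<in>A. \<nu> (s, a))))
      * log_factor \<gamma> \<nu>min (sup_norm (S \<times> A) \<theta>0) * rtd_rate \<epsilon> \<gamma> \<nu>min"
proof -
  let ?X = "S \<times> A" and ?K = "state_action_kernel \<pi> PN" and ?G = "robust_bellman S A c \<gamma> PN U \<pi>"
    and ?Q = "Q_robust S A c \<gamma> PN U \<pi>" and ?r = "sup_norm (S \<times> A) \<theta>0"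
  define L where "L = 2 + 4 * real (mixing_time S (state_kernel A \<pi> PN) (\<lambda>s. \<Sum>a\<in>A. \<nu> (s, a)))"
  obtain \<kappa> where \<kappa>: "0 \<le> \<kappa>" "\<kappa> \<le> 1" and fx: "\<And>x z z' y. z \<in> S \<times> A \<Longrightarrow> f x (z, z') y = x y
      + (?G x z - x z + \<kappa> * (x z' - (\<Sum>z''\<in>S \<times> A. ?K z z'' * x z''))) * basis_vec z y"
    using rtd_operator_form[OF f] by blast
  have X: "finite ?X" "?X \<noteq> {}" using S A by auto
  note K = state_action_kernel_simplex[OF S(1) A(1) nominal \<pi>]
  have \<nu>: "\<nu> \<in> prob_simplex ?X" using stat by (simp add: stationary_def)
  interpret td: td_process ?X ?K \<nu> L ?G ?Q \<gamma> "1 / (1 - \<gamma>)" \<kappa>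
  proof
    fix x y :: "'s \<times> 'a \<Rightarrow> real" and m z
    assume le: "\<And>z. z \<in> ?X \<Longrightarrow> \<bar>x z - y z\<bar> \<le> m" and z: "z \<in> ?X"
    have "x z \<le> y z + m" "y z \<le> x z + m" if "z \<in> ?X" for z
      using le[OF that] by linarith+
    then have "?G x z \<le> ?G y z + \<gamma> * m" "?G y z \<le> ?G x z + \<gamma> * m"
      by (intro robust_bellman_le \<pi> z; blast)+
    then show "\<bar>?G x z - ?G y z\<bar> \<le> \<gamma> * m" by linarith
  next
    show "(\<Sum>i<n. \<Sum>y\<in>?X. \<bar>kernel_pow ?X ?K i z y - \<nu> y\<bar>) \<le> L" if "z \<in> ?X" for n z
      unfolding L_def by (rule sum_kernel_pow_state_action_L1_le[OF S(1) A(1) nominal \<pi> stat irr aper that])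
    show "0 \<le> ?Q z \<and> ?Q z \<le> 1 / (1 - \<gamma>)" if "z \<in> ?X" for z
      using Q_robust_bounds[OF \<pi> that] by simp
  qed (use X K \<nu> \<kappa> discount Q_robust_fixed_point[OF \<pi>] in \<open>simp_all add: less_imp_le\<close>)
  have \<nu>min_le: "\<nu>min \<le> \<nu> y" if "y \<in> ?X" for y
    using X that by (simp add: \<nu>min)
  have \<nu>1: "\<nu>min \<le> 1"
    using X \<nu>min_le td.\<nu>_le_1 by (meson ex_in_conv order_trans)
  have L: "1 \<le> L" by (simp add: L_def)
  have r: "0 \<le> ?r"
    using X le_sup_norm[of ?X _ \<theta>0] by (meson abs_ge_zero ex_in_conv order_trans)
  define \<delta> where "\<delta> = (1 - \<gamma>) * \<nu>min / 32"
  have \<delta>: "0 < \<delta>" "\<delta> \<le> 1"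
    using discount \<nu>min(2) \<nu>1 mult_le_one[of "1 - \<gamma>" \<nu>min] by (auto simp: \<delta>_def)
  obtain B J :: nat where B: "0 < B" "sqrt (L / B) \<le> \<delta>" "1 / (1 - \<gamma>) * sqrt (L / B) / \<delta> \<le> \<epsilon> / 2"
    and J: "(1 - \<delta>) ^ J * (?r + 1 / (1 - \<gamma>)) \<le> \<epsilon> / 2"
    and T: "real (B * J) \<le> 4194304 * L * log_factor \<gamma> \<nu>min ?r * rtd_rate \<epsilon> \<gamma> \<nu>min"
    using block_parameters[OF \<epsilon> discount \<nu>min(2) \<nu>1 r L \<delta>_def] by blast
  define \<alpha> where "\<alpha> = 1 / real (8 * B)"
  let ?g = "\<lambda>\<theta> (_ :: 's \<times> 'a). sup_norm ?X (\<lambda>y. \<theta> y - ?Q y)"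
  have init: "?g \<theta>0 z \<le> ?r + 1 / (1 - \<gamma>)" for z
    unfolding sup_norm_le_iff[OF X]
  proof
    fix y assume y: "y \<in> ?X"
    show "\<bar>\<theta>0 y - ?Q y\<bar> \<le> ?r + 1 / (1 - \<gamma>)"
      using le_sup_norm[OF X(1) y, of \<theta>0] Q_robust_bounds[OF \<pi> y] by linarith
  qed
  have bound: "(step_op ?X ?K (td.td_upd \<alpha>) ^^ (B * J)) ?g \<theta>0 z \<le> \<epsilon>" if z: "z \<in> ?X" for z
  proof -
    have "(step_op ?X ?K (td.td_upd \<alpha>) ^^ (B * J)) ?g \<theta>0 z
        \<le> (1 - \<delta>) ^ J * ?g \<theta>0 z + 1 / (1 - \<gamma>) * sqrt (L / B) / \<delta>"
      using discount by (intro td.blocks_expectation[OF B(1) \<alpha>_def _ L \<nu>min_le z \<delta> \<delta>_def B(2)]) auto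
    also have "(1 - \<delta>) ^ J * ?g \<theta>0 z \<le> (1 - \<delta>) ^ J * (?r + 1 / (1 - \<gamma>))"
      using \<delta> init by (intro mult_left_mono) auto
    finally show ?thesis using J B(3) by linarith
  qed
  define \<mu> where "\<mu> = (\<lambda>(s, a). if s = s0 then \<pi> s a else 0)"
  have \<mu>: "\<mu> \<in> prob_simplex ?X"
  proof -
    have "(\<Sum>z\<in>?X. \<mu> z) = (\<Sum>s\<in>S. \<Sum>a\<in>A. if s = s0 then \<pi> s a else 0)"
      by (simp add: \<mu>_def sum.cartesian_product)
    also have "\<dots> = (\<Sum>s\<in>S. if s = s0 then \<Sum>a\<in>A. \<pi> s a else 0)"
      by (intro sum.cong) auto
    also have "\<dots> = 1"
      using S s0 \<pi> by (simp add: policies_def prob_simplex_def)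
    finally show ?thesis
      using s0 \<pi> by (auto simp: prob_simplex_def policies_def \<mu>_def)
  qed
  have law: "rtd_trajectory S A PN \<pi> s0 = chain_law ?X \<mu> ?K"
    by (simp add: rtd_trajectory_def \<mu>_def)
  \<comment> \<open>Along trajectories inside the carrier the sampled operator agrees with the
    abstract update; the law is supported on these.\<close>
  have run: "rtd f (\<lambda>t. \<alpha>) \<theta>0 \<omega> t = run (td.td_upd \<alpha>) \<theta>0 \<omega> t" if "\<And>t. \<omega> t \<in> ?X" for \<omega> t
    using fx[OF that] by (induction t) (simp_all add: td.td_upd_def td.avg_def)
  have "(LINT \<omega>|rtd_trajectory S A PN \<pi> s0. sup_norm ?X (\<lambda>z. rtd f (\<lambda>t. \<alpha>) \<theta>0 \<omega> (B * J) z - ?Q z))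
      = (LINT \<omega>|chain_law ?X \<mu> ?K. ?g (run (td.td_upd \<alpha>) \<theta>0 \<omega> (B * J)) (\<omega> (B * J)))"
    unfolding law
  proof (rule Bochner_Integration.integral_cong)
    fix \<omega> assume "\<omega> \<in> space (chain_law ?X \<mu> ?K)"
    then have "\<omega> t \<in> ?X" for t
      using space_chain_law[of ?X \<mu> ?K, OF X(1) \<mu> K] by auto
    then show "sup_norm ?X (\<lambda>z. rtd f (\<lambda>t. \<alpha>) \<theta>0 \<omega> (B * J) z - ?Q z)
        = ?g (run (td.td_upd \<alpha>) \<theta>0 \<omega> (B * J)) (\<omega> (B * J))"
      by (simp only: run)
  qed simp
  also have "\<dots> = (\<Sum>z\<in>?X. \<mu> z * (step_op ?X ?K (td.td_upd \<alpha>) ^^ (B * J)) ?g \<theta>0 z)"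
  proof (rule integral_chain_law_run(1)[OF X(1) \<mu> K])
    fix \<theta> :: "'s \<times> 'a \<Rightarrow> real" and z assume "z \<in> ?X"
    then show "0 \<le> ?g \<theta> z"
      using le_sup_norm[OF X(1), of z "\<lambda>y. \<theta> y - ?Q y"] by linarith
  qed
  also have "\<dots> \<le> \<epsilon>"
    by (intro prob_simplex_sum_le[OF \<mu>] bound)
  finally have "(LINT \<omega>|rtd_trajectory S A PN \<pi> s0.
      sup_norm ?X (\<lambda>z. rtd f (\<lambda>t. \<alpha>) \<theta>0 \<omega> (B * J) z - ?Q z)) \<le> \<epsilon>" .
  then show ?thesis
    using B(1) T by (intro exI[of _ \<alpha>] exI[of _ "B * J"]) (simp add: \<alpha>_def L_def)
qed

text \<open>The constant is linear in the mixing time of the state chain and the logarithmic factor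
  enters with power \<open>k = 1\<close>.\<close>

theorem lemma5p1:
  shows "\<exists>(C :: nat \<Rightarrow> real) (k :: nat).
    \<forall>(S :: 's set) (A :: 'a set) c \<gamma> PN U \<pi> \<nu> \<nu>min f s0 \<theta>0 \<epsilon>.
      robust_mdp S A c \<gamma> PN U \<longrightarrow>
      \<pi> \<in> policies S A \<longrightarrow>
      (\<forall>s\<in>S. \<forall>a\<in>A. 0 < \<pi> s a) \<longrightarrow>
      irreducible_chain S (state_kernel A \<pi> PN) \<longrightarrow>
      aperiodic_chain S (state_kernel A \<pi> PN) \<longrightarrow>
      stationary (S \<times> A) (state_action_kernel \<pi> PN) \<nu> \<longrightarrow>
      \<nu>min = Min (\<nu> ` (S \<times> A)) \<longrightarrow>
      0 < \<nu>min \<longrightarrow>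
      rtd_operator S A c \<gamma> PN U \<pi> f \<longrightarrow>
      s0 \<in> S \<longrightarrow>
      0 < \<epsilon> \<longrightarrow>
      (\<exists>(\<alpha>::real) (T::nat).
         0 < \<alpha> \<and>
         (LINT \<omega>|rtd_trajectory S A PN \<pi> s0.
            sup_norm (S \<times> A)
              (\<lambda>z. rtd f (\<lambda>t. \<alpha>) \<theta>0 \<omega> T z - Q_robust S A c \<gamma> PN U \<pi> z)) \<le> \<epsilon> \<and>
         real T \<le> C (mixing_time S (state_kernel A \<pi> PN) (\<lambda>s. \<Sum>a\<in>A. \<nu> (s, a)))
                    * log_factor \<gamma> \<nu>min (sup_norm (S \<times> A) \<theta>0) ^ k
                    * rtd_rate (min \<epsilon> (1 / 2)) \<gamma> \<nu>min)"
proof (rule exI[of _ "\<lambda>t. 4194304 * (2 + 4 * real t)"], rule exI[of _ 1], intro allI impI, goal_cases)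
  case (1 S A c \<gamma> PN U \<pi> \<nu> \<nu>min f s0 \<theta>0 \<epsilon>)
  \<comment> \<open>Accuracy \<open>min \<epsilon> (1 / 2)\<close> implies accuracy \<epsilon> and
    is where the rate is evaluated.\<close>
  then have e: "0 < min \<epsilon> (1 / 2)" "min \<epsilon> (1 / 2) \<le> 1 / 2"
    by auto
  from robust_mdp.rtd_sample_complexity[OF 1(1,2,4-10) e, of \<theta>0] obtain \<alpha> :: real and T :: nat
    where "0 < \<alpha>" "(LINT \<omega>|rtd_trajectory S A PN \<pi> s0. sup_norm (S \<times> A)
       (\<lambda>z. rtd f (\<lambda>t. \<alpha>) \<theta>0 \<omega> T z - Q_robust S A c \<gamma> PN U \<pi> z)) \<le> min \<epsilon> (1 / 2)"
    "real T \<le> 4194304 * (2 + 4 * real (mixing_time S (state_kernel A \<pi> PN) (\<lambda>s. \<Sum>a\<in>A. \<nu> (s, a))))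
      * log_factor \<gamma> \<nu>min (sup_norm (S \<times> A) \<theta>0) * rtd_rate (min \<epsilon> (1 / 2)) \<gamma> \<nu>min"
    by blast
  then show ?case
    by (intro exI[of _ \<alpha>] exI[of _ T]) auto
qed

end
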